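(* Let $R$ be a finite commutative ring with unity $1\neq 0$, and write $R\cong R_1\times\cdots\times R_s$ ($s\ge 1$), where each $R_i$ is a finite local ring with unique maximal ideal $M_i$, the factors being ordered so that $|R_1|/|M_1|\geq \cdots\geq |R_s|/|M_s|$. Then the unitary Cayley graph $G_R$ is periodic if and only if either $R_1/M_1\cong \mathbb{Z}_2$ or $R_1/M_1\cong\mathbb{Z}_3$, and $R_i/M_i\cong\mathbb{Z}_2$ for all $i\in\{2,\ldots,s\}$.
   Context: Every finite commutative ring with unity decomposes (uniquely up to order) as a direct product of finite local rings. $R^\times$ denotes the group of units of $R$. The unitary Cayley graph $G_R=\operatorname{Cay}(R,R^\times)$ has vertex set $R$, with distinct vertices $u,v$ adjacent iff $u-v\in R^\times$. Grover walk on a finite simple graph $G$ without isolated vertices: let $\mathcal{A}(G)=\{(u,v),(v,u): uv\in E(G)\}$ be the set of arcs; for $a=(u,v)$ put $t(a)=v$ and $a^{-1}=(v,u)$. The boundary matrix $N\in\mathbb{C}^{V(G)\times\mathcal{A}(G)}$ is $N_{ua}=\frac{1}{\sqrt{\deg u}}\delta_{u,t(a)}$, the shift matrix $S\in\mathbb{C}^{\mathcal{A}(G)\times\mathcal{A}(G)}$ is $S_{ab}=\delta_{a,b^{-1}}$, and the time evolution matrix is $U=S(2N^*N-I)$. The graph $G$ is called periodic if $U^\tau=I$ for some positive integer $\tau$. *)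

theory Defs
  imports
    Complex_Main
    "HOL-Algebra.Chinese_Remainder"
    "HOL-Number_Theory.Residues"
    "Graph_Theory.Pair_Digraph"
begin

text \<open>Matrices with rows and columns indexed by sets are functions of two arguments; only the
  entries at indices in these sets are meaningful. \<open>idx_mult K\<close> is the product of matrices with
  common index set \<open>K\<close>, and \<open>idx_pow K\<close> the power of a \<open>K\<close>-by-\<open>K\<close> matrix.\<close>

definition idx_one :: "'i \<Rightarrow> 'i \<Rightarrow> complex" where
  "idx_one i j = (if i = j then 1 else 0)"

definition idx_mult ::
    "'k set \<Rightarrow> ('i \<Rightarrow> 'k \<Rightarrow> complex) \<Rightarrow> ('k \<Rightarrow> 'j \<Rightarrow> complex) \<Rightarrow> 'i \<Rightarrow> 'j \<Rightarrow> complex" where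
  "idx_mult K A B i j = (\<Sum>k\<in>K. A i k * B k j)"

definition idx_adjoint :: "('i \<Rightarrow> 'j \<Rightarrow> complex) \<Rightarrow> 'j \<Rightarrow> 'i \<Rightarrow> complex" where
  "idx_adjoint A j i = cnj (A i j)"

primrec idx_pow :: "'k set \<Rightarrow> ('k \<Rightarrow> 'k \<Rightarrow> complex) \<Rightarrow> nat \<Rightarrow> 'k \<Rightarrow> 'k \<Rightarrow> complex" where
  "idx_pow K A 0 = idx_one"
| "idx_pow K A (Suc n) = idx_mult K (idx_pow K A n) A"

text \<open>A finite simple graph is a \<^locale>\<open>pair_graph\<close>: an edge \<open>uv\<close> is represented by the two arcs
  \<open>(u, v)\<close> and \<open>(v, u)\<close>, so \<open>parcs G\<close> is the set of arcs of the Grover walk, the terminus of an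
  arc is its second component, the inverse arc is obtained by \<^const>\<open>prod.swap\<close>, and the degree of
  a vertex is its out-degree.\<close>

definition grover_boundary :: "'a pair_pre_digraph \<Rightarrow> 'a \<Rightarrow> 'a \<times> 'a \<Rightarrow> complex" where
  "grover_boundary G u a =
     1 / complex_of_real (sqrt (real (out_degree (with_proj G) u))) * (if u = snd a then 1 else 0)"

definition grover_shift :: "'a \<times> 'a \<Rightarrow> 'a \<times> 'a \<Rightarrow> complex" where
  "grover_shift a b = (if a = prod.swap b then 1 else 0)"

definition grover_evolution :: "'a pair_pre_digraph \<Rightarrow> 'a \<times> 'a \<Rightarrow> 'a \<times> 'a \<Rightarrow> complex" where
  "grover_evolution G =
     idx_mult (parcs G) grover_shift
       (\<lambda>a b. 2 * idx_mult (pverts G) (idx_adjoint (grover_boundary G)) (grover_boundary G) a b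
              - idx_one a b)"

definition grover_periodic :: "'a pair_pre_digraph \<Rightarrow> bool" where
  "grover_periodic G \<longleftrightarrow>
     (\<exists>\<tau>>0. \<forall>a\<in>parcs G. \<forall>b\<in>parcs G. idx_pow (parcs G) (grover_evolution G) \<tau> a b = idx_one a b)"

definition unitary_cayley_graph :: "'a ring \<Rightarrow> 'a pair_pre_digraph" where
  "unitary_cayley_graph R =
     \<lparr>pverts = carrier R,
      parcs = {(u, v). u \<in> carrier R \<and> v \<in> carrier R \<and> u \<noteq> v \<and> u \<ominus>\<^bsub>R\<^esub> v \<in> Units R}\<rparr>"

definition local_ring_with :: "'a ring \<Rightarrow> 'a set \<Rightarrow> bool" where
  "local_ring_with R M \<longleftrightarrow> cring R \<and> {I. maximalideal I R} = {M}"

text \<open>Unitary Cayley graphs are finite simple graphs without isolated vertices, so the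
  definitions of the Grover walk apply to them.\<close>

lemma pair_graph_unitary_cayley_graph:
  fixes R :: "'a ring" (structure)
  assumes "cring R" "finite (carrier R)"
  shows "pair_graph (unitary_cayley_graph R)"
proof -
  interpret cring R by fact
  let ?A = "parcs (unitary_cayley_graph R)"
  have "?A \<subseteq> carrier R \<times> carrier R"
    by (auto simp: unitary_cayley_graph_def)
  then have fin: "finite ?A"
    using assms(2) by (meson finite_SigmaI finite_subset)
  have sym: "(v, u) \<in> ?A" if "(u, v) \<in> ?A" for u v
  proof -
    from that have uv: "u \<in> carrier R" "v \<in> carrier R" "u \<noteq> v" "u \<ominus> v \<in> Units R"
      by (auto simp: unitary_cayley_graph_def)
    have "v \<ominus> u = (\<ominus> \<one>) \<otimes> (u \<ominus> v)"
      using uv by algebra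
    moreover have "\<ominus> \<one> \<in> Units R"
      by (rule Units_minus_one_closed)
    ultimately have "v \<ominus> u \<in> Units R"
      using uv(4) by simp
    then show ?thesis
      using uv by (auto simp: unitary_cayley_graph_def)
  qed
  have "symmetric (with_proj (unitary_cayley_graph R))"
    unfolding symmetric_def sym_def using sym by (auto simp: arcs_ends_def arc_to_ends_def)
  then show ?thesis
    using fin assms(2) by unfold_locales (auto simp: unitary_cayley_graph_def)
qed

lemma unitary_cayley_graph_no_isolated:
  fixes R :: "'a ring" (structure)
  assumes "cring R" "\<one>\<^bsub>R\<^esub> \<noteq> \<zero>\<^bsub>R\<^esub>" "u \<in> pverts (unitary_cayley_graph R)"
  shows "\<exists>v. (u, v) \<in> parcs (unitary_cayley_graph R)"
proof -
  interpret cring R by fact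
  have u: "u \<in> carrier R"
    using assms(3) by (simp add: unitary_cayley_graph_def)
  have eq: "u \<ominus> (u \<ominus> \<one>) = \<one>"
    using u by algebra
  have "u \<noteq> u \<ominus> \<one>"
    using eq u assms(2) by (metis minus_eq r_neg)
  then have "(u, u \<ominus> \<one>) \<in> parcs (unitary_cayley_graph R)"
    using u eq by (simp add: unitary_cayley_graph_def)
  then show ?thesis ..
qed

end

theory Submission imports Defs begin

text \<open>Let \<open>T = A/k\<close> be the normalised adjacency matrix of a \<open>k\<close>-regular graph.  The sums over the
  arcs entering a vertex obey the Chebyshev recurrence \<open>J (n + 2) = 2 T J (n + 1) - J n\<close> under the
  walk.  On an integer eigenfunction of \<open>T\<close> with rational eigenvalue \<open>\<mu>\<close>, a periodic solution forces
  \<open>2 \<mu>\<close> to be an integer by a divisibility descent.  Conversely, if the eigenvalues of \<open>T\<close> lie in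
  \<open>{0, 1/2, -1/2, 1, -1}\<close>, the recurrence gives \<open>(U^12 - 1)^3 = 0\<close>, and \<open>U^12 = 1\<close> because \<open>U\<close>
  is an isometry.  Two elements of a product of local rings are adjacent iff all their residues
  differ, so with \<open>q i\<close> the order of the \<open>i\<close>-th residue field the eigenvalues are, up to \<open>0\<close>, the
  products of the numbers \<open>- 1 / (q i - 1)\<close> over sets of indices.\<close>

section \<open>The Grover walk on a regular graph\<close>

text \<open>This is the action of \<open>U\<close> on functions on the arcs of a
  \<open>k\<close>-regular graph: a reflection at the vertex \<open>u\<close>, read along the
  reversed arc. The entries of \<open>U\<close> are real, so real functions suffice.\<close>

definition walk_step :: "('v \<times> 'v) set \<Rightarrow> nat \<Rightarrow> ('v \<times> 'v \<Rightarrow> real) \<Rightarrow> 'v \<times> 'v \<Rightarrow> real" where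
  "walk_step A k x = (\<lambda>(u, v). 2 / real k * (\<Sum>w | (w, u) \<in> A. x (w, u)) - x (v, u))"

text \<open>By the recurrence all values \<open>z n\<close> lie in \<open>\<int>/D\<close> for a common denominator \<open>D\<close>; conversely
  \<open>b\<close> divides every \<open>D * z (n + 1)\<close>, and this can be iterated.\<close>

lemma periodic_recurrence_unit:
  fixes z :: "nat \<Rightarrow> real" and a b :: int
  assumes rec: "\<And>n. of_int b * z (n + 2) = of_int a * z (n + 1) - of_int b * z n"
    and "coprime a b"
    and z01: "z 0 \<in> \<int>" "z 1 \<in> \<int>"
    and period: "\<And>n. z (n + \<tau>) = z n" and "\<tau> > 0"
    and "z 0 \<noteq> 0"
  shows "is_unit b"
proof (cases "b = 0")
  \<comment> \<open>With \<open>b = 0\<close>, coprimality makes \<open>a\<close> nonzero and the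
    recurrence kills every \<open>z (n + 1)\<close>; the period carries this back to
    \<open>z 0\<close>.\<close>
  case True
  then have "is_unit a" using \<open>coprime a b\<close> by simp
  then have "a \<noteq> 0" by auto
  then have "z (n + 1) = 0" for n
    using rec[of n] True by simp
  from this[of "\<tau> - 1"] have "z \<tau> = 0"
    using \<open>\<tau> > 0\<close> by simp
  then show ?thesis
    using period[of 0] \<open>z 0 \<noteq> 0\<close> by simp
next
  case False
  have den: "of_int b ^ n * z n \<in> \<int> \<and> of_int b ^ n * z (n + 1) \<in> \<int>" for n
  proof (induction n)
    case 0
    then show ?case using z01 by simp
  next
    case (Suc n)
    have "of_int b ^ Suc n * z (Suc n + 1) = of_int b ^ n * (of_int b * z (n + 2))"
      by simp
    also have "\<dots> = of_int a * (of_int b ^ n * z (n + 1)) - of_int b * (of_int b ^ n * z n)"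
      unfolding rec by (simp add: algebra_simps)
    also have "\<dots> \<in> \<int>"
      using Suc by (intro Ints_diff Ints_mult[OF Ints_of_int]) simp_all
    finally have "of_int b ^ Suc n * z (Suc n + 1) \<in> \<int>" .
    moreover have "of_int b * (of_int b ^ n * z (n + 1)) \<in> \<int>"
      using Suc by (intro Ints_mult[OF Ints_of_int]) simp
    ultimately show ?case
      by (simp add: mult.assoc)
  qed
  have mult_period: "z (n + j * \<tau>) = z n" for n j
    by (induction j) (simp_all add: period add.assoc[symmetric] add.commute[of \<tau>])
  \<comment> \<open>A single exponent serves all \<open>n\<close>: the period allows
    \<open>n\<close> to be replaced by \<open>n mod \<tau>\<close>, which is below
    \<open>\<tau>\<close>.\<close>
  have "of_int b ^ \<tau> * z n \<in> \<int>" for n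
  proof -
    have "of_int b ^ \<tau> * z n = of_int b ^ (\<tau> - n mod \<tau>) * (of_int b ^ (n mod \<tau>) * z (n mod \<tau>))"
      using \<open>\<tau> > 0\<close> mult_period[of "n mod \<tau>" "n div \<tau>"]
      by (simp add: mult.assoc[symmetric] power_add[symmetric])
    then show ?thesis using den by auto
  qed
  then have "\<forall>n. \<exists>w. of_int b ^ \<tau> * z n = of_int w"
    by (metis Ints_cases)
  then obtain w where w: "\<And>n. of_int b ^ \<tau> * z n = of_int (w n)"
    by metis
  have w_rec: "b * (w (n + 2) + w n) = a * w (n + 1)" for n
  proof -
    have "of_int b * (of_int (w (n + 2)) + of_int (w n)) = of_int a * (of_int (w (n + 1)) :: real)"
      unfolding w[symmetric] using arg_cong[OF rec[of n], of "(*) (of_int b ^ \<tau>)"]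
      by (simp add: algebra_simps)
    then show ?thesis
      by (simp flip: of_int_add of_int_mult)
  qed
  have w_period: "w \<tau> = w 0"
  proof -
    have "of_int (w \<tau>) = (of_int (w 0) :: real)"
      using period[of 0] by (simp flip: w)
    then show ?thesis by simp
  qed
  have dvd: "\<forall>n. b ^ j dvd w n" for j
  proof (induction j)
    case (Suc j)
    \<comment> \<open>The recurrence contributes one more factor \<open>b\<close> on the left of
      \<open>w_rec\<close>, and coprimality removes \<open>a\<close> on the right.\<close>
    have *: "b ^ Suc j dvd w (n + 1)" for n
    proof -
      have "b ^ j dvd w (n + 2) + w n"
        using Suc by simp
      then have "b ^ Suc j dvd a * w (n + 1)"
        unfolding w_rec[symmetric] by simp
      moreover have "coprime (b ^ Suc j) a"
        using \<open>coprime a b\<close> by (simp add: coprime_commute)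
      ultimately show ?thesis
        by (simp add: coprime_dvd_mult_right_iff del: power_Suc)
    qed
    \<comment> \<open>Index 0 is not of the form \<open>n + 1\<close>; it is reached through
      \<open>w \<tau> = w 0\<close>.\<close>
    have "b ^ Suc j dvd w 0"
      using *[of "\<tau> - 1"] \<open>\<tau> > 0\<close> w_period by simp
    then show ?case
      using * by (metis Suc_eq_plus1 old.nat.exhaust)
  qed simp
  have "w 0 \<noteq> 0"
    using w[of 0] \<open>z 0 \<noteq> 0\<close> False by auto
  have "\<bar>b\<bar> < 2"
  proof (rule ccontr)
    assume "\<not> \<bar>b\<bar> < 2"
    \<comment> \<open>For this exponent \<open>b ^ j\<close> would exceed the nonzero integer
      \<open>w 0\<close>, which it divides.\<close>
    define j where "j = nat \<bar>w 0\<bar>"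
    have "int j < 2 ^ j"
      by (metis of_nat_less_two_power)
    also have "\<dots> \<le> \<bar>b\<bar> ^ j"
      using \<open>\<not> \<bar>b\<bar> < 2\<close> by (intro power_mono) auto
    also have "\<dots> \<le> \<bar>w 0\<bar>"
      using dvd_imp_le_int[OF \<open>w 0 \<noteq> 0\<close>, of "b ^ j"] dvd by (simp add: power_abs)
    finally show False by (simp add: j_def)
  qed
  then show ?thesis using False by auto
qed

section \<open>The evolution matrix as an operator on arc functions\<close>

locale regular_arcs =
  fixes V :: "'v set" and A :: "('v \<times> 'v) set" and k :: nat
  assumes finite_verts: "finite V"
    and arcs_subset: "A \<subseteq> V \<times> V"
    and arcs_sym: "(u, v) \<in> A \<Longrightarrow> (v, u) \<in> A"
    and degree: "u \<in> V \<Longrightarrow> card {w. (w, u) \<in> A} = k"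
    and degree_pos: "k > 0"
begin

abbreviation step where "step \<equiv> walk_step A k"

abbreviation nb where "nb u \<equiv> {w. (w, u) \<in> A}"

lemma finite_arcs: "finite A"
  using finite_verts arcs_subset finite_subset by blast

lemma nb_subset: "nb u \<subseteq> V"
  using arcs_subset by auto

lemma finite_nb [simp]: "finite (nb u)"
  using nb_subset finite_verts finite_subset by blast

lemma sum_arcs: "(\<Sum>a\<in>A. g a) = (\<Sum>u\<in>V. \<Sum>w\<in>nb u. g (u, w))"
proof -
  have "A = Sigma V nb"
    using arcs_subset arcs_sym by auto
  then show ?thesis
    using finite_verts by (simp add: sum.Sigma)
qed

lemma sum_arcs_swap: "(\<Sum>a\<in>A. g (prod.swap a)) = (\<Sum>a\<in>A. g a)"
  by (rule sum.reindex_bij_witness[of _ prod.swap prod.swap]) (auto dest: arcs_sym)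

text \<open>On arcs the matrix \<open>U\<close> acts as \<open>step\<close>, hence
  \<open>U^\<tau>\<close> as its iterate; conversely, indicator functions of arcs recover the matrix
  entries.\<close>

lemma grover_periodic_iff:
  assumes G: "pverts G = V" "parcs G = A"
  shows "grover_periodic G \<longleftrightarrow> (\<exists>\<tau>>0. \<forall>x. \<forall>a\<in>A. (step ^^ \<tau>) x a = x a)"
proof -
  let ?U = "grover_evolution G"
  \<comment> \<open>\<open>out_degree\<close> counts outgoing arcs and \<open>nb\<close> incoming
    ones; symmetry identifies the two.\<close>
  have deg: "out_degree (with_proj G) u = k" if "u \<in> V" for u
  proof -
    have "out_arcs (with_proj G) u = Pair u ` nb u"
      using arcs_sym by (auto simp: out_arcs_def G)
    then show ?thesis
      by (simp add: out_degree_def card_image inj_on_def degree[OF that])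
  qed
  \<comment> \<open>The shift replaces row \<open>(u, v)\<close> by row \<open>(v, u)\<close>, whose
    terminus is \<open>u\<close>; the two normalising square roots multiply to
    \<open>k\<close>.\<close>
  have U: "?U (u, v) b = (2 / k) * (if u = snd b then 1 else 0) - idx_one (v, u) b"
    if "(u, v) \<in> A" for u v b
  proof -
    let ?D = "\<lambda>a b. 2 * idx_mult V (idx_adjoint (grover_boundary G)) (grover_boundary G) a b
              - idx_one a b"
    have u: "u \<in> V" using that arcs_subset by auto
    have sqrt_k: "complex_of_real (sqrt k) * complex_of_real (sqrt k) = of_nat k"
      by (simp flip: of_real_mult)
    have "?U (u, v) b = (\<Sum>c\<in>A. (if c = (v, u) then ?D c b else 0))"
      unfolding grover_evolution_def idx_mult_def[of A] G grover_shift_def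
      by (intro sum.cong) auto
    also have "\<dots> = ?D (v, u) b"
      using arcs_sym[OF that] finite_arcs by simp
    also have "idx_mult V (idx_adjoint (grover_boundary G)) (grover_boundary G) (v, u) b
      = (\<Sum>x\<in>V. if x = u then complex_of_real (1 / k) * (if u = snd b then 1 else 0) else 0)"
      unfolding idx_mult_def idx_adjoint_def grover_boundary_def
      by (intro sum.cong) (auto simp: deg sqrt_k)
    also have "\<dots> = (1 / k) * (if u = snd b then 1 else 0)"
      using u finite_verts by simp
    finally show ?thesis by simp
  qed
  have app: "(\<Sum>b\<in>A. ?U a b * of_real (x b)) = of_real (step x a)" if a: "a \<in> A" for a x
  proof -
    obtain u v where uv: "a = (u, v)" by (cases a)
    have 1: "(\<Sum>b\<in>A. (if u = snd b then x b else 0)) = (\<Sum>w\<in>nb u. x (w, u))"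
    proof -
      have "(\<Sum>b\<in>A. (if u = snd b then x b else 0)) = (\<Sum>b\<in>{b\<in>A. u = snd b}. x b)"
        using finite_arcs by (simp add: sum.inter_filter)
      also have "{b\<in>A. u = snd b} = (\<lambda>w. (w, u)) ` nb u" by auto
      also have "sum x \<dots> = (\<Sum>w\<in>nb u. x (w, u))"
        by (subst sum.reindex) (auto simp: inj_on_def)
      finally show ?thesis .
    qed
    have 2: "(\<Sum>b\<in>A. (if b = (v, u) then x b else 0)) = x (v, u)"
      using arcs_sym a uv finite_arcs by simp
    have "(\<Sum>b\<in>A. ?U a b * of_real (x b)) =
      (\<Sum>b\<in>A. of_real (2 / k * (if u = snd b then x b else 0) - (if b = (v, u) then x b else 0)))"
      using a unfolding uv by (intro sum.cong) (auto simp: U idx_one_def algebra_simps)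
    also have "\<dots> = of_real (2 / k * (\<Sum>b\<in>A. (if u = snd b then x b else 0))
       - (\<Sum>b\<in>A. (if b = (v, u) then x b else 0)))"
      unfolding of_real_sum[symmetric] sum_subtractf sum_distrib_left[symmetric] ..
    finally show ?thesis
      unfolding 1 2 uv by (simp add: walk_step_def)
  qed
  have pow: "(\<Sum>b\<in>A. idx_pow A ?U n a b * of_real (x b)) = of_real ((step ^^ n) x a)"
    if a: "a \<in> A" for a n x
  \<comment> \<open>\<open>idx_pow\<close> multiplies by \<open>U\<close> on the right, so one
    factor acts on \<open>x\<close> first and the hypothesis is needed for
    \<open>step x\<close>.\<close>
  proof (induction n arbitrary: x)
    case 0
    have "(\<Sum>b\<in>A. idx_one a b * complex_of_real (x b)) = (\<Sum>b\<in>A. if b = a then of_real (x b) else 0)"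
      by (intro sum.cong) (auto simp: idx_one_def)
    then show ?case using a finite_arcs by simp
  next
    case (Suc n)
    have "(\<Sum>b\<in>A. idx_pow A ?U (Suc n) a b * of_real (x b))
      = (\<Sum>b\<in>A. \<Sum>c\<in>A. idx_pow A ?U n a c * (?U c b * of_real (x b)))"
      by (simp add: idx_mult_def sum_distrib_right mult.assoc)
    also have "\<dots> = (\<Sum>c\<in>A. idx_pow A ?U n a c * (\<Sum>b\<in>A. ?U c b * of_real (x b)))"
      by (subst sum.swap) (simp add: sum_distrib_left)
    also have "\<dots> = (\<Sum>c\<in>A. idx_pow A ?U n a c * of_real (step x c))"
      by (simp add: app)
    also have "\<dots> = of_real ((step ^^ n) (step x) a)"
      by (rule Suc)
    finally show ?case by (simp add: funpow_swap1)
  qed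
  have "(\<forall>a\<in>A. \<forall>b\<in>A. idx_pow A ?U \<tau> a b = idx_one a b) \<longleftrightarrow>
    (\<forall>x. \<forall>a\<in>A. (step ^^ \<tau>) x a = x a)" (is "?l \<longleftrightarrow> ?r") for \<tau>
  proof
    assume ?l
    show ?r
    proof (intro allI ballI)
      fix x a assume a: "a \<in> A"
      have "complex_of_real ((step ^^ \<tau>) x a) = (\<Sum>b\<in>A. idx_pow A ?U 0 a b * of_real (x b))"
        using \<open>?l\<close> a by (simp flip: pow)
      also have "\<dots> = of_real (x a)"
        by (subst pow[OF a]) simp
      finally show "(step ^^ \<tau>) x a = x a" by (simp only: of_real_eq_iff)
    qed
  next
    assume r: ?r
    show ?l
    proof (intro ballI)
      fix a b assume a: "a \<in> A" and b: "b \<in> A"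
      let ?x = "\<lambda>c. if c = b then 1 else 0"
      have "idx_pow A ?U \<tau> a b = (\<Sum>c\<in>A. if c = b then idx_pow A ?U \<tau> a c else 0)"
        using b finite_arcs by simp
      also have "\<dots> = (\<Sum>c\<in>A. idx_pow A ?U \<tau> a c * of_real (?x c))"
        by (intro sum.cong) auto
      also have "\<dots> = of_real (?x a)"
        using r a by (simp add: pow)
      finally show "idx_pow A ?U \<tau> a b = idx_one a b"
        by (simp add: idx_one_def)
    qed
  qed
  then show ?thesis
    unfolding grover_periodic_def G by simp
qed

section \<open>Linearity and isometry of the walk\<close>

lemma step_diff: "step (\<lambda>a. x a - y a) = (\<lambda>a. step x a - step y a)"
  by (auto simp: walk_step_def sum_subtractf algebra_simps)

lemma funpow_step_diff: "(step ^^ n) (\<lambda>a. x a - y a) = (\<lambda>a. (step ^^ n) x a - (step ^^ n) y a)"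
  by (induction n) (simp_all add: step_diff)

lemma step_cong:
  assumes "\<And>a. a \<in> A \<Longrightarrow> x a = y a" "a \<in> A"
  shows "step x a = step y a"
  using assms arcs_sym by (cases a) (auto simp: walk_step_def)

text \<open>On the arcs entering \<open>u\<close> the walk is twice the projection onto constants
  minus the identity, so the cross terms cancel: \<open>4/k - 2/k - 2/k = 0\<close>. Reversing arcs
  afterwards only permutes the summands.\<close>

lemma step_isometry: "(\<Sum>a\<in>A. step x a * step y a) = (\<Sum>a\<in>A. x a * y a)"
proof -
  have "(\<Sum>a\<in>A. step x a * step y a) = (\<Sum>u\<in>V. \<Sum>w\<in>nb u. step x (u, w) * step y (u, w))"
    by (rule sum_arcs)
  also have "\<dots> = (\<Sum>u\<in>V. \<Sum>w\<in>nb u. x (w, u) * y (w, u))"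
  proof (rule sum.cong[OF refl])
    fix u assume u: "u \<in> V"
    define a b where "a = (\<Sum>w\<in>nb u. x (w, u))" and "b = (\<Sum>w\<in>nb u. y (w, u))"
    have "(\<Sum>w\<in>nb u. step x (u, w) * step y (u, w)) =
      (\<Sum>w\<in>nb u. 4 / real k ^ 2 * a * b - 2 / k * a * y (w, u) - 2 / k * b * x (w, u)
         + x (w, u) * y (w, u))"
      by (intro sum.cong refl) (simp add: walk_step_def a_def[symmetric] b_def[symmetric]
        algebra_simps power2_eq_square)
    also have "\<dots> = k * (4 / real k ^ 2 * a * b) - 2 / k * a * b - 2 / k * b * a
         + (\<Sum>w\<in>nb u. x (w, u) * y (w, u))"
      unfolding sum.distrib sum_subtractf sum_distrib_left[symmetric] a_def[symmetric] b_def[symmetric]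
      by (simp add: degree u)
    also have "\<dots> = (\<Sum>w\<in>nb u. x (w, u) * y (w, u))"
      using degree_pos by (simp add: field_simps power2_eq_square)
    finally show "(\<Sum>w\<in>nb u. step x (u, w) * step y (u, w)) = (\<Sum>w\<in>nb u. x (w, u) * y (w, u))" .
  qed
  also have "\<dots> = (\<Sum>a\<in>A. (\<lambda>a. x a * y a) (prod.swap a))"
    by (simp add: sum_arcs)
  also have "\<dots> = (\<Sum>a\<in>A. x a * y a)"
    by (rule sum_arcs_swap)
  finally show ?thesis .
qed

lemma funpow_step_isometry:
  "(\<Sum>a\<in>A. (step ^^ n) x a * (step ^^ n) y a) = (\<Sum>a\<in>A. x a * y a)"
  by (induction n) (simp_all add: step_isometry)

text \<open>Since \<open>step\<close> is an isometry, its powers have no Jordan blocks for the eigenvalue 1.\<close>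

lemma funpow_step_fixed:
  assumes fixed: "\<And>a. a \<in> A \<Longrightarrow>
      (step ^^ n) (\<lambda>b. (step ^^ n) x b - x b) a = (step ^^ n) x a - x a"
    and "a \<in> A"
  shows "(step ^^ n) x a = x a"
proof -
  let ?d = "\<lambda>b. (step ^^ n) x b - x b"
  \<comment> \<open>With \<open>W = step ^^ n\<close> and \<open>d = W x - x\<close> fixed by
    \<open>W\<close>, the isometry gives \<open><W x, d> = <W x, W d> = <x, d>\<close>, hence
    \<open><d, d> = 0\<close>.\<close>
  have "(\<Sum>b\<in>A. (step ^^ n) x b * ?d b) = (\<Sum>b\<in>A. (step ^^ n) x b * (step ^^ n) ?d b)"
    using fixed by (intro sum.cong) auto
  also have "\<dots> = (\<Sum>b\<in>A. x b * ?d b)"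
    by (rule funpow_step_isometry)
  finally have "(\<Sum>b\<in>A. ?d b * ?d b) = 0"
    by (simp add: sum_subtractf algebra_simps sum.distrib sum_distrib_left)
  then have "\<forall>b\<in>A. ?d b * ?d b = 0"
    by (subst (asm) sum_nonneg_eq_0_iff) (auto simp: finite_arcs)
  then show ?thesis
    using \<open>a \<in> A\<close> by auto
qed

text \<open>This is \<open>2 T\<close>. The factor 2 makes the recurrence monic and turns the
  eigenvalues 0, 1/2, -1/2, 1, -1 into the roots of \<open>t^5 - 5 t^3 + 4 t\<close>.\<close>

definition twice_mean :: "('v \<Rightarrow> real) \<Rightarrow> 'v \<Rightarrow> real" where
  "twice_mean f u = 2 / k * (\<Sum>w\<in>nb u. f w)"

lemma twice_mean_cong: "(\<And>w. w \<in> V \<Longrightarrow> f w = g w) \<Longrightarrow> twice_mean f u = twice_mean g u"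
  unfolding twice_mean_def using nb_subset by (intro arg_cong2[where f = "(*)"] sum.cong) auto

lemma twice_mean_add: "twice_mean (\<lambda>w. f w + g w) = (\<lambda>u. twice_mean f u + twice_mean g u)"
  by (simp add: fun_eq_iff twice_mean_def sum.distrib algebra_simps)

lemma twice_mean_cmult: "twice_mean (\<lambda>w. c * f w) = (\<lambda>u. c * twice_mean f u)"
  by (simp add: fun_eq_iff twice_mean_def sum_distrib_left algebra_simps)

text \<open>The in-sums \<open>J\<close> satisfy the Chebyshev recurrence of \<open>twice_mean\<close>, and with the shift \<open>E\<close> the
  hypothesis on \<open>twice_mean\<close> becomes \<open>(E^10 - E^6 - E^4 + 1) J = 0\<close>, that is,
  \<open>(E^6 - 1) (E^4 - 1) J = 0\<close>.  As \<open>(E^2 - 1) step^n x\<close> is determined by \<open>J\<close>, the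
  sequence \<open>step^n x\<close> is annihilated by \<open>(E^2 - 1) (E^4 - 1) (E^6 - 1)\<close>, which divides
  \<open>(E^12 - 1)^3\<close>.\<close>

lemma period_12:
  assumes minpoly: "\<And>f u. u \<in> V \<Longrightarrow> (twice_mean ^^ 5) f u - 5 * (twice_mean ^^ 3) f u + 4 * twice_mean f u = 0"
    and a: "a \<in> A"
  shows "(step ^^ 12) x a = x a"
proof -
  define X where "X n = (step ^^ n) x" for n
  define J where "J n u = (\<Sum>w\<in>nb u. X n (w, u))" for n u
  have X_Suc: "X (Suc n) (u, v) = 2 / k * J n u - X n (v, u)" for n u v
    by (simp add: X_def J_def walk_step_def)
  have J_rec: "twice_mean (J (n + 1)) u = J (n + 2) u + J n u" if u: "u \<in> V" for n u
  proof -
    have "J (n + 2) u = (\<Sum>w\<in>nb u. 2 / k * J (n + 1) w - X (n + 1) (u, w))"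
      unfolding J_def[of "n + 2"] using X_Suc[of "n + 1"] by simp
    also have "\<dots> = twice_mean (J (n + 1)) u - (\<Sum>w\<in>nb u. 2 / k * J n u - X n (w, u))"
      by (simp add: sum_subtractf twice_mean_def X_Suc sum_distrib_left)
    also have "(\<Sum>w\<in>nb u. 2 / k * J n u - X n (w, u)) = J n u"
      using degree_pos by (simp add: sum_subtractf degree[OF u] J_def[of n])
    finally show ?thesis by simp
  qed
  \<comment> \<open>By \<open>J_rec\<close>, \<open>twice_mean\<close> acts on the sequence
    \<open>J\<close> as \<open>E + E^-1\<close>, so its powers produce binomial coefficients at
    every second index.\<close>
  have J2: "(twice_mean ^^ 2) (J (n + 2)) u = J (n + 4) u + 2 * J (n + 2) u + J n u" if u: "u \<in> V" for n u
  proof -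
    have "(twice_mean ^^ 2) (J (n + 2)) u = twice_mean (\<lambda>u. J (n + 3) u + J (n + 1) u) u"
      using J_rec[of _ "n + 1"] by (auto simp: numeral_2_eq_2 eval_nat_numeral intro!: twice_mean_cong)
    also have "\<dots> = twice_mean (J (n + 2 + 1)) u + twice_mean (J (n + 1)) u"
      by (simp add: twice_mean_add eval_nat_numeral)
    finally show ?thesis
      unfolding J_rec[OF u] by (simp add: eval_nat_numeral)
  qed
  have J3: "(twice_mean ^^ 3) (J (n + 3)) u = J (n + 6) u + 3 * J (n + 4) u + 3 * J (n + 2) u + J n u"
    if u: "u \<in> V" for n u
  proof -
    have "(twice_mean ^^ 3) (J (n + 3)) u = twice_mean ((twice_mean ^^ 2) (J (n + 1 + 2))) u"
      by (simp add: eval_nat_numeral)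
    also have "\<dots> = twice_mean (\<lambda>u. J (n + 4 + 1) u + 2 * J (n + 2 + 1) u + J (n + 1) u) u"
      by (intro twice_mean_cong, subst J2) (auto simp: add.commute)
    also have "\<dots> = twice_mean (J (n + 4 + 1)) u + 2 * twice_mean (J (n + 2 + 1)) u + twice_mean (J (n + 1)) u"
      by (simp add: twice_mean_add twice_mean_cmult)
    finally show ?thesis
      unfolding J_rec[OF u] by (simp add: eval_nat_numeral)
  qed
  have J5: "(twice_mean ^^ 5) (J (n + 5)) u = J (n + 10) u + 5 * J (n + 8) u + 10 * J (n + 6) u
      + 10 * J (n + 4) u + 5 * J (n + 2) u + J n u"
    if u: "u \<in> V" for n u
  proof -
    have "(twice_mean ^^ 5) (J (n + 5)) u = (twice_mean ^^ 2) ((twice_mean ^^ 3) (J (n + 2 + 3))) u"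
      by (simp add: eval_nat_numeral)
    also have "\<dots> = (twice_mean ^^ 2) (\<lambda>u. J (n + 6 + 2) u + 3 * J (n + 4 + 2) u + 3 * J (n + 2 + 2) u
        + J (n + 2) u) u"
      unfolding numeral_2_eq_2 funpow.simps o_apply id_apply
      by (intro twice_mean_cong, subst J3[unfolded numeral_2_eq_2]) (auto simp: add.commute)
    also have "\<dots> = (twice_mean ^^ 2) (J (n + 6 + 2)) u + 3 * (twice_mean ^^ 2) (J (n + 4 + 2)) u
        + 3 * (twice_mean ^^ 2) (J (n + 2 + 2)) u + (twice_mean ^^ 2) (J (n + 2)) u"
      unfolding numeral_2_eq_2 by (simp add: twice_mean_add twice_mean_cmult cong: twice_mean_cong)
    finally show ?thesis
      unfolding J2[OF u] by (simp add: eval_nat_numeral)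
  qed
  have J: "J (n + 10) u - J (n + 6) u - J (n + 4) u + J n u = 0" if u: "u \<in> V" for n u
    using minpoly[OF u, of "J (n + 5)"] J5[OF u, of n] J3[OF u, of "n + 2"] J_rec[OF u, of "n + 4"]
    by (simp add: eval_nat_numeral)
  have XJ: "X (n + 2) (u, v) = X n (u, v) + 2 / k * (J (n + 1) u - J n v)" for n u v
    using X_Suc[of "n + 1" u v] X_Suc[of n v u] by (simp add: algebra_simps)
  define D where "D n b = X (n + 2) b - X n b" for n b
  have D: "D (n + 10) b - D (n + 6) b - D (n + 4) b + D n b = 0" if b: "b \<in> A" for n b
  proof -
    obtain u v where uv: "b = (u, v)" by (cases b)
    then have V: "u \<in> V" "v \<in> V" using b arcs_subset by auto
    have DJ: "D n b = 2 / k * (J (n + 1) u - J n v)" for n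
      unfolding D_def uv XJ by simp
    have "D (n + 10) b - D (n + 6) b - D (n + 4) b + D n b =
       2 / k * ((J (n + 1 + 10) u - J (n + 1 + 6) u - J (n + 1 + 4) u + J (n + 1) u)
         - (J (n + 10) v - J (n + 6) v - J (n + 4) v + J n v))"
      unfolding DJ by (simp add: algebra_simps)
    then show ?thesis
      unfolding J[OF V(1)] J[OF V(2)] by simp
  qed
  \<comment> \<open>The cofactor of \<open>(E^2 - 1) (E^4 - 1) (E^6 - 1)\<close> in
    \<open>(E^12 - 1)^3\<close> is a polynomial in \<open>E^2\<close> of degree 12, so the thirteen
    even shifts of \<open>D\<close> from 0 to 24 suffice.\<close>
  have cube: "X (n + 36) b - 3 * X (n + 24) b + 3 * X (n + 12) b - X n b = 0" if b: "b \<in> A" for n b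
    using D[OF b, of n] D[OF b, of "n + 2"] D[OF b, of "n + 4"] D[OF b, of "n + 6"]
      D[OF b, of "n + 8"] D[OF b, of "n + 10"] D[OF b, of "n + 12"] D[OF b, of "n + 14"]
      D[OF b, of "n + 16"] D[OF b, of "n + 18"] D[OF b, of "n + 20"] D[OF b, of "n + 22"]
      D[OF b, of "n + 24"]
    unfolding D_def add.assoc by simp
  have comp: "(step ^^ m) (X n) = X (n + m)" for m n
    by (simp add: X_def funpow_add add.commute)
  \<comment> \<open>\<open>cube\<close> says \<open>(step^12 - 1)^3 x = 0\<close>. Two uses of
    \<open>funpow_step_fixed\<close>, first for \<open>y\<close> and then for \<open>X 0\<close>,
    lower the exponent to 1.\<close>
  define y where "y b = X 12 b - X 0 b" for b
  have y1: "(step ^^ 12) y = (\<lambda>b. X 24 b - X 12 b)"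
    unfolding y_def funpow_step_diff comp by simp
  have y2: "(step ^^ 12) (\<lambda>b. (step ^^ 12) y b - y b) = (\<lambda>b. (X 36 b - X 24 b) - (X 24 b - X 12 b))"
    unfolding y1 funpow_step_diff unfolding y_def comp funpow_step_diff by simp
  have y: "(step ^^ 12) y b = y b" if b: "b \<in> A" for b
  proof (rule funpow_step_fixed)
    show "(step ^^ 12) (\<lambda>b. (step ^^ 12) y b - y b) a = (step ^^ 12) y a - y a" if "a \<in> A" for a
      using cube[OF that, of 0] unfolding y2 unfolding y1 y_def by simp
  qed (rule b)
  have "(step ^^ 12) (X 0) b = X 0 b" if b: "b \<in> A" for b
  proof (rule funpow_step_fixed)
    have "(\<lambda>b. (step ^^ 12) (X 0) b - X 0 b) = y"
      unfolding y_def comp by simp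
    then show "(step ^^ 12) (\<lambda>b. (step ^^ 12) (X 0) b - X 0 b) a = (step ^^ 12) (X 0) a - X 0 a"
      if "a \<in> A" for a
      using y[OF that] by (metis (no_types, lifting))
  qed (rule b)
  then show ?thesis
    using a by (simp add: X_def)
qed

text \<open>If \<open>f\<close> is an eigenfunction, \<open>step\<close> acts on the span of \<open>f \<circ> fst\<close> and \<open>f \<circ> snd\<close>.\<close>

lemma eigenvalue_denominator:
  fixes f :: "'v \<Rightarrow> real" and \<mu> :: real and a b :: int
  assumes periodic: "\<And>x a. a \<in> A \<Longrightarrow> (step ^^ \<tau>) x a = x a" "\<tau> > 0"
    and eigen: "\<And>u. u \<in> V \<Longrightarrow> (\<Sum>w\<in>nb u. f w) = \<mu> * k * f u"
    and ints: "\<And>u. u \<in> V \<Longrightarrow> f u \<in> \<int>"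
    and v: "v \<in> V" "f v \<noteq> 0"
    and "coprime a b" and ratio: "2 * of_int b * \<mu> = of_int a"
  shows "is_unit b"
proof -
  have "nb v \<noteq> {}"
    using degree[OF v(1)] degree_pos by (metis card.empty less_irrefl)
  then obtain u where uv: "(u, v) \<in> A" by auto
  then have u: "u \<in> V" using arcs_subset by auto
  \<comment> \<open>The orbit of \<open>f \<circ> snd\<close> is observed on a single arc into
    \<open>v\<close>, so that \<open>z 0 = f v\<close> is nonzero and \<open>z 1 = f u\<close> is an
    integer.\<close>
  define z where "z n = (step ^^ n) (\<lambda>(u, v). f v) (u, v)" for n
  let ?g = "\<lambda>(u, v). f v"
  have two: "(step ^^ (n + 2)) ?g (u, v) = 2 * \<mu> * (step ^^ (n + 1)) ?g (u, v) - (step ^^ n) ?g (u, v)"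
    if "(u, v) \<in> A" for n u v
    using that
  proof (induction n arbitrary: u v)
    case 0
    have one: "step ?g (w, w') = f w" if "w \<in> V" for w w'
      using that degree_pos by (simp add: walk_step_def degree)
    have "u \<in> V" "v \<in> V" using 0 arcs_subset by auto
    have "(step ^^ 2) ?g (u, v) = 2 / k * (\<Sum>w\<in>nb u. step ?g (w, u)) - step ?g (v, u)"
      by (simp add: eval_nat_numeral walk_step_def[of _ _ "walk_step A k _"])
    also have "\<dots> = 2 / k * (\<Sum>w\<in>nb u. f w) - f v"
      using nb_subset \<open>v \<in> V\<close> by (auto simp: one subset_iff)
    also have "\<dots> = 2 * \<mu> * f u - f v"
      using degree_pos by (simp add: eigen \<open>u \<in> V\<close>)
    finally show ?case using one[OF \<open>u \<in> V\<close>] by (simp add: eval_nat_numeral)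
  next
    case (Suc n)
    have lin: "step (\<lambda>a. 2 * \<mu> * x a - y a) = (\<lambda>a. 2 * \<mu> * step x a - step y a)" for x y
      by (auto simp: walk_step_def sum_subtractf sum_distrib_left algebra_simps)
    have "(step ^^ (Suc n + 2)) ?g (u, v) = step ((step ^^ (n + 2)) ?g) (u, v)" by simp
    \<comment> \<open>The induction hypothesis holds on arcs only, and \<open>step\<close> at an arc
      reads values only on arcs.\<close>
    also have "\<dots> = step (\<lambda>a. 2 * \<mu> * (step ^^ (n + 1)) ?g a - (step ^^ n) ?g a) (u, v)"
      using Suc by (intro step_cong) auto
    finally show ?case by (simp add: lin)
  qed
  show ?thesis
  proof (rule periodic_recurrence_unit)
    show "of_int b * z (n + 2) = of_int a * z (n + 1) - of_int b * z n" for n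
      unfolding z_def two[OF uv] ratio[symmetric] by (simp add: algebra_simps)
    show "z (n + \<tau>) = z n" for n
      unfolding z_def add.commute[of n] funpow_add o_apply by (rule periodic) (rule uv)
    show "z 0 \<in> \<int>" "z 0 \<noteq> 0"
      using v ints by (simp_all add: z_def)
    have "z 1 = f u"
      using u degree_pos by (simp add: z_def walk_step_def degree)
    then show "z 1 \<in> \<int>" using ints u by simp
  qed fact+
qed

end

section \<open>Graphs given by coordinates\<close>

text \<open>In the application \<open>c v i\<close> is the residue of \<open>v\<close> in the
  \<open>i\<close>-th residue field \<open>Q i\<close>. Each tuple of residues has the same number
  \<open>m\<close> of preimages, namely the product of the orders of the maximal ideals.\<close>

locale coordinates =
  fixes V :: "'v set" and I :: "'i set" and Q :: "'i \<Rightarrow> 'b set" and c :: "'v \<Rightarrow> 'i \<Rightarrow> 'b" and m :: nat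
  assumes finite_V: "finite V" and finite_I: "finite I"
    and finite_Q: "i \<in> I \<Longrightarrow> finite (Q i)"
    and card_Q: "i \<in> I \<Longrightarrow> card (Q i) \<ge> 2"
    and coord: "v \<in> V \<Longrightarrow> i \<in> I \<Longrightarrow> c v i \<in> Q i"
    and fibre: "g \<in> Pi\<^sub>E I Q \<Longrightarrow> card {v \<in> V. restrict (c v) I = g} = m"
    and m_pos: "m > 0"
begin

text \<open>Up to replacing each vertex by \<open>m\<close> copies, this is the tensor product of
  the complete graphs on the sets \<open>Q i\<close>.\<close>

definition box_arcs :: "('v \<times> 'v) set" where
  "box_arcs = {(u, v). u \<in> V \<and> v \<in> V \<and> (\<forall>i\<in>I. c u i \<noteq> c v i)}"

definition deg :: nat where
  "deg = m * (\<Prod>i\<in>I. card (Q i) - 1)"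

text \<open>Grouping the vertices by their coordinate tuple gives \<open>m\<close> equal terms per
  tuple; the sum over tuples then factors by distributivity.\<close>

lemma box_sum:
  fixes g :: "'i \<Rightarrow> 'b \<Rightarrow> real"
  assumes S: "\<And>i. i \<in> I \<Longrightarrow> S i \<subseteq> Q i"
  shows "(\<Sum>v | v \<in> V \<and> (\<forall>i\<in>I. c v i \<in> S i). \<Prod>i\<in>I. g i (c v i)) = m * (\<Prod>i\<in>I. \<Sum>b\<in>S i. g i b)"
proof -
  let ?B = "{v. v \<in> V \<and> (\<forall>i\<in>I. c v i \<in> S i)}"
  have fin_S: "finite (S i)" if "i \<in> I" for i
    using S[OF that] finite_Q[OF that] finite_subset by blast
  have fin_B: "finite ?B" using finite_V by simp
  have "(\<Sum>v\<in>?B. \<Prod>i\<in>I. g i (c v i)) =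
    (\<Sum>h\<in>Pi\<^sub>E I S. \<Sum>v | v \<in> ?B \<and> restrict (c v) I = h. \<Prod>i\<in>I. g i (c v i))"
    using fin_B finite_I fin_S by (intro sum.group[symmetric] finite_PiE) auto
  also have "\<dots> = (\<Sum>h\<in>Pi\<^sub>E I S. m * (\<Prod>i\<in>I. g i (h i)))"
  proof (rule sum.cong[OF refl])
    fix h assume h: "h \<in> Pi\<^sub>E I S"
    have eq: "{v \<in> ?B. restrict (c v) I = h} = {v \<in> V. restrict (c v) I = h}"
      using h by (auto simp: PiE_iff)
    have "(\<Sum>v | v \<in> ?B \<and> restrict (c v) I = h. \<Prod>i\<in>I. g i (c v i))
      = (\<Sum>v | v \<in> V \<and> restrict (c v) I = h. \<Prod>i\<in>I. g i (h i))"
      unfolding eq by (intro sum.cong prod.cong) auto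
    also have "\<dots> = m * (\<Prod>i\<in>I. g i (h i))"
      using h S by (subst sum_constant, subst fibre) (auto simp: PiE_iff)
    finally show "(\<Sum>v | v \<in> ?B \<and> restrict (c v) I = h. \<Prod>i\<in>I. g i (c v i)) = m * (\<Prod>i\<in>I. g i (h i))" .
  qed
  also have "\<dots> = m * (\<Prod>i\<in>I. \<Sum>b\<in>S i. g i b)"
    using finite_I fin_S by (simp add: prod_sum_PiE sum_distrib_left)
  finally show ?thesis .
qed

lemma box_card:
  assumes "\<And>i. i \<in> I \<Longrightarrow> S i \<subseteq> Q i"
  shows "card {v \<in> V. \<forall>i\<in>I. c v i \<in> S i} = m * (\<Prod>i\<in>I. card (S i))"
proof -
  have "real (card {v \<in> V. \<forall>i\<in>I. c v i \<in> S i}) = m * (\<Prod>i\<in>I. real (card (S i)))"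
    using box_sum[OF assms, where g = "\<lambda>_ _. 1"] by simp
  then show ?thesis
    by (simp only: of_nat_prod[symmetric] of_nat_mult[symmetric] of_nat_eq_iff)
qed

lemma box_arcs_into: "u \<in> V \<Longrightarrow> {w. (w, u) \<in> box_arcs} = {w. w \<in> V \<and> (\<forall>i\<in>I. c w i \<in> Q i - {c u i})}"
  using coord by (auto simp: box_arcs_def)

sublocale regular_arcs V box_arcs deg
proof
  show "card {w. (w, u) \<in> box_arcs} = deg" if "u \<in> V" for u
    unfolding box_arcs_into[OF that] deg_def using that coord finite_Q
    by (subst box_card) (auto intro!: prod.cong)
  show "deg > 0"
    unfolding deg_def using m_pos card_Q by (auto intro!: prod_pos dest!: card_Q)
qed (use finite_V in \<open>auto simp: box_arcs_def\<close>)

lemma nonempty_V: "V \<noteq> {}"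
proof -
  have "card {v \<in> V. \<forall>i\<in>I. c v i \<in> Q i} > 0"
    using card_Q m_pos by (subst box_card) (auto intro!: prod_pos dest!: card_Q)
  then show ?thesis by auto
qed

text \<open>The eigenfunctions used are products of the functions \<open>card (Q i) * indicator {c v i} - 1\<close>
  on the factors \<open>Q i\<close>, with \<open>i \<in> J\<close> and a fixed vertex \<open>v\<close>.\<close>

lemma periodic_denominator:
  fixes a b :: int
  assumes periodic: "\<And>x a. a \<in> box_arcs \<Longrightarrow> (step ^^ \<tau>) x a = x a" "\<tau> > 0"
    and J: "J \<subseteq> I"
    and ab: "coprime a b" "2 * of_int b * (\<Prod>i\<in>J. - 1 / (real (card (Q i)) - 1)) = of_int a"
  shows "is_unit b"
proof -
  obtain v where v: "v \<in> V" using nonempty_V by blast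
  define e :: "'i \<Rightarrow> 'b \<Rightarrow> real" where
    "e i x = (if i \<in> J then (if x = c v i then real (card (Q i)) - 1 else - 1) else 1)" for i x
  define l :: "'i \<Rightarrow> real" where
    "l i = (if i \<in> J then - 1 else real (card (Q i)) - 1)" for i
  define f where "f u = (\<Prod>i\<in>I. e i (c u i))" for u
  define \<mu> where "\<mu> = (\<Prod>i\<in>J. - 1 / (real (card (Q i)) - 1))"
  have q: "real (card (Q i)) \<ge> 2" if "i \<in> I" for i
    using card_Q[OF that] by simp
  \<comment> \<open>Each \<open>e i\<close> is an eigenfunction of the complete graph on
    \<open>Q i\<close>: constant 1 outside \<open>J\<close>, and of total sum 0 for \<open>i\<close>
    in \<open>J\<close>, which gives the eigenvalue -1.\<close>
  have e_sum: "(\<Sum>x\<in>Q i - {y}. e i x) = l i * e i y" if i: "i \<in> I" and y: "y \<in> Q i" for i y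
  proof (cases "i \<in> J")
    case False
    then show ?thesis
      using i y finite_Q card_Q[OF i] by (simp add: e_def l_def of_nat_diff)
  next
    case True
    have "(\<Sum>x\<in>Q i. e i x) = (\<Sum>x\<in>Q i. (if x = c v i then real (card (Q i)) else 0) - 1)"
      using True by (intro sum.cong) (auto simp: e_def)
    also have "\<dots> = 0"
      using i v coord finite_Q by (simp add: sum_subtractf)
    finally show ?thesis
      using y finite_Q[OF i] True by (simp add: sum_diff1 l_def)
  qed
  \<comment> \<open>Dividing the product of the factor eigenvalues by the degree cancels the indices
    outside \<open>J\<close>.\<close>
  have l_prod: "m * (\<Prod>i\<in>I. l i) = \<mu> * deg"
  proof -
    have "\<mu> = (\<Prod>i\<in>I. if i \<in> J then - 1 / (real (card (Q i)) - 1) else 1)"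
      unfolding \<mu>_def using J finite_I by (simp add: prod.If_cases Int_absorb1)
    moreover have "real deg = m * (\<Prod>i\<in>I. real (card (Q i)) - 1)"
      unfolding deg_def of_nat_mult of_nat_prod using card_Q
      by (intro arg_cong2[where f = "(*)"] prod.cong) (auto dest!: card_Q)
    moreover have "(\<Prod>i\<in>I. if i \<in> J then - 1 / (real (card (Q i)) - 1) else 1)
      * (\<Prod>i\<in>I. real (card (Q i)) - 1) = (\<Prod>i\<in>I. l i)"
      unfolding prod.distrib[symmetric] l_def using q by (intro prod.cong) (auto dest!: q)
    ultimately show ?thesis by simp
  qed
  show ?thesis
  proof (rule eigenvalue_denominator[where f = f and \<mu> = \<mu>])
    show "(step ^^ \<tau>) x a = x a" if "a \<in> box_arcs" for x a
      using that by (rule periodic)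
    show "(\<Sum>w | (w, u) \<in> box_arcs. f w) = \<mu> * deg * f u" if u: "u \<in> V" for u
    proof -
      have "(\<Sum>w | (w, u) \<in> box_arcs. f w) = m * (\<Prod>i\<in>I. \<Sum>x\<in>Q i - {c u i}. e i x)"
        unfolding f_def box_arcs_into[OF u] by (rule box_sum) auto
      also have "\<dots> = m * (\<Prod>i\<in>I. l i * e i (c u i))"
        using u coord by (simp add: e_sum)
      also have "\<dots> = \<mu> * deg * f u"
        by (simp add: prod.distrib f_def flip: l_prod)
      finally show ?thesis .
    qed
    show "f u \<in> \<int>" if "u \<in> V" for u
      unfolding f_def by (intro Ints_prod) (auto simp: e_def)
    have "e i (c v i) \<noteq> 0" if "i \<in> I" for i
      using q[OF that] by (auto simp: e_def)
    then show "f v \<noteq> 0"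
      using finite_I by (simp add: f_def)
    show "2 * of_int b * \<mu> = of_int a"
      using ab by (simp add: \<mu>_def)
  qed fact+
qed

section \<open>Sufficiency: the square of the adjacency operator as class sums\<close>

definition cls :: "'i set \<Rightarrow> ('v \<Rightarrow> real) \<Rightarrow> 'v \<Rightarrow> real" where
  "cls J f u = (\<Sum>w | w \<in> V \<and> (\<forall>i\<in>J. c w i = c u i). f w)"

lemma cls_cong: "(\<And>w. w \<in> V \<Longrightarrow> f w = g w) \<Longrightarrow> cls J f u = cls J g u"
  unfolding cls_def by (intro sum.cong) auto

lemma cls_add: "cls J (\<lambda>w. f w + g w) u = cls J f u + cls J g u"
  by (simp add: cls_def sum.distrib)

lemma cls_divide: "cls J (\<lambda>w. f w / r) u = cls J f u / r"
  by (simp add: cls_def sum_divide_distrib)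

lemma cls_invariant:
  fixes f :: "'v \<Rightarrow> real"
  assumes "\<And>w. w \<in> V \<Longrightarrow> \<forall>i\<in>J. c w i = c u i \<Longrightarrow> f w = f u"
  shows "cls J f u = card {w \<in> V. \<forall>i\<in>J. c w i = c u i} * f u"
  unfolding cls_def using assms by simp

text \<open>Neighbourhoods depend on coordinates alone, so \<open>twice_mean f\<close> is constant
  on fibres, which have size \<open>m\<close>.\<close>

lemma cls_twice_mean:
  assumes "u \<in> V"
  shows "cls I (twice_mean f) u = m * twice_mean f u"
proof -
  have "cls I (twice_mean f) u = card {w \<in> V. \<forall>i\<in>I. c w i = c u i} * twice_mean f u"
    using assms by (intro cls_invariant) (simp add: twice_mean_def box_arcs_into)
  also have "{w \<in> V. \<forall>i\<in>I. c w i = c u i} = {w \<in> V. \<forall>i\<in>I. c w i \<in> {c u i}}" by simp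
  also have "card \<dots> = m"
    using assms coord by (subst box_card) auto
  finally show ?thesis .
qed

text \<open>A class sum is constant on its classes; forgetting coordinate \<open>j\<close> makes
  these of size \<open>m * card (Q j)\<close>.\<close>

lemma cls_cls:
  assumes "u \<in> V" "j \<in> I"
  shows "cls (I - {j}) (cls (I - {j}) f) u = m * card (Q j) * cls (I - {j}) f u"
proof -
  have "cls (I - {j}) (cls (I - {j}) f) u
      = card {w \<in> V. \<forall>i\<in>I - {j}. c w i = c u i} * cls (I - {j}) f u"
    by (intro cls_invariant) (simp add: cls_def)
  also have "{w \<in> V. \<forall>i\<in>I - {j}. c w i = c u i}
      = {w \<in> V. \<forall>i\<in>I. c w i \<in> (if i = j then Q j else {c u i})}"
    using coord \<open>j \<in> I\<close> by auto
  also have "card \<dots> = m * (\<Prod>i\<in>I. card (if i = j then Q j else {c u i}))"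
    using assms coord by (subst box_card) auto
  also have "(\<Prod>i\<in>I. card (if i = j then Q j else {c u i})) = (\<Prod>i\<in>I. if i = j then card (Q j) else 1)"
    by (intro prod.cong) auto
  also have "\<dots> = card (Q j)"
    using assms finite_I by simp
  finally show ?thesis by simp
qed

text \<open>The product, multiplied by \<open>m\<close>, counts the common neighbours of
  \<open>u\<close> and \<open>w\<close>, that is, the two-step walks between them.\<close>

lemma twice_mean_iterated:
  assumes u: "u \<in> V"
  shows "twice_mean (twice_mean f) u =
    4 / real deg ^ 2 * (\<Sum>w\<in>V. m * (\<Prod>i\<in>I. real (card (Q i - {c u i, c w i}))) * f w)"
proof -
  have "(\<Sum>v | (v, u) \<in> box_arcs. \<Sum>w | (w, v) \<in> box_arcs. f w) =
    (\<Sum>v | (v, u) \<in> box_arcs. \<Sum>w\<in>V. if (w, v) \<in> box_arcs then f w else 0)"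
  proof (rule sum.cong[OF refl])
    fix v
    have "{w. (w, v) \<in> box_arcs} = {w \<in> V. (w, v) \<in> box_arcs}"
      by (auto simp: box_arcs_def)
    then show "(\<Sum>w | (w, v) \<in> box_arcs. f w) = (\<Sum>w\<in>V. if (w, v) \<in> box_arcs then f w else 0)"
      using finite_V by (simp add: sum.inter_filter)
  qed
  also have "\<dots> = (\<Sum>w\<in>V. \<Sum>v | (v, u) \<in> box_arcs. if (w, v) \<in> box_arcs then f w else 0)"
    by (rule sum.swap)
  also have "\<dots> = (\<Sum>w\<in>V. m * (\<Prod>i\<in>I. real (card (Q i - {c u i, c w i}))) * f w)"
  proof (rule sum.cong[OF refl])
    fix w assume w: "w \<in> V"
    have "{v. (v, u) \<in> box_arcs} \<inter> {v. (w, v) \<in> box_arcs}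
      = {v \<in> V. \<forall>i\<in>I. c v i \<in> Q i - {c u i, c w i}}"
      using u w coord by (auto simp: box_arcs_def)
    then have "card ({v. (v, u) \<in> box_arcs} \<inter> {v. (w, v) \<in> box_arcs})
      = m * (\<Prod>i\<in>I. card (Q i - {c u i, c w i}))"
      using box_card[of "\<lambda>i. Q i - {c u i, c w i}"] by (simp only: Diff_subset)
    then show "(\<Sum>v | (v, u) \<in> box_arcs. if (w, v) \<in> box_arcs then f w else 0)
      = m * (\<Prod>i\<in>I. real (card (Q i - {c u i, c w i}))) * f w"
      by (simp add: sum.If_cases)
  qed
  finally show ?thesis
    unfolding twice_mean_def sum_distrib_left[symmetric] by (simp add: power2_eq_square)
qed

text \<open>For \<open>i \<noteq> j\<close> the set \<open>Q i\<close> has two elements, so vertices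
  with a common neighbour agree in coordinate \<open>i\<close>. Hence the square of
  \<open>t = twice_mean\<close> is a combination of \<open>cls I\<close> and
  \<open>cls (I - {j})\<close>, and \<open>t^5 - 5 t^3 + 4 t = 0\<close> follows.\<close>

lemma periodic_if_small:
  assumes j: "j \<in> I" and q: "card (Q j) = 2 \<or> card (Q j) = 3"
    and others: "\<And>i. i \<in> I - {j} \<Longrightarrow> card (Q i) = 2"
    and a: "a \<in> box_arcs"
  shows "(step ^^ 12) x a = x a"
proof (rule period_12[OF _ a])
  fix f :: "'v \<Rightarrow> real" and u assume u: "u \<in> V"
  have m: "real m > 0" using m_pos by simp
  have deg: "deg = m * (card (Q j) - 1)"
    unfolding deg_def using others by (simp add: prod.remove[OF finite_I j])
  have card2: "card (S - {x, y}) = (if x = y then card S - 1 else card S - 2)"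
    if "finite S" "x \<in> S" "y \<in> S" for S :: "'b set" and x y
    using that by (cases "x = y") (auto simp: card_Diff_subset)
  have common: "(\<Prod>i\<in>I. real (card (Q i - {c u i, c w i}))) =
      real (card (Q j - {c u j, c w j})) * (if \<forall>i\<in>I - {j}. c w i = c u i then 1 else 0)"
    if u: "u \<in> V" and w: "w \<in> V" for u w
  proof -
    have "(\<Prod>i\<in>I - {j}. real (card (Q i - {c u i, c w i})))
      = (\<Prod>i\<in>I - {j}. if c w i = c u i then 1 else 0)"
      using others coord finite_Q u w by (intro prod.cong) (auto simp: card2)
    also have "\<dots> = (if \<forall>i\<in>I - {j}. c w i = c u i then 1 else 0)"
      using finite_I by (auto intro!: prod.neutral prod_zero)
    finally show ?thesis
      by (simp add: prod.remove[OF finite_I j])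
  qed
  have all: "(\<forall>i\<in>I. c w i = c u i) \<longleftrightarrow> c w j = c u j \<and> (\<forall>i\<in>I - {j}. c w i = c u i)" for u w
    using j by auto
  have cls_if: "cls J f u = (\<Sum>w\<in>V. if \<forall>i\<in>J. c w i = c u i then f w else 0)" for J f u
    unfolding cls_def using finite_V by (simp add: sum.inter_filter)
  show "(twice_mean ^^ 5) f u - 5 * (twice_mean ^^ 3) f u + 4 * twice_mean f u = 0"
  proof (cases "card (Q j) = 2")
    case True
    have "twice_mean (twice_mean f) u = 4 / m * cls I f u" if u: "u \<in> V" for f u
    proof -
      have "m * (\<Prod>i\<in>I. real (card (Q i - {c u i, c w i}))) * f w
        = m * (if \<forall>i\<in>I. c w i = c u i then f w else 0)" if w: "w \<in> V" for w
        unfolding common[OF u w] all using coord[OF u j] coord[OF w j] finite_Q[OF j] True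
        by (auto simp: card2)
      then have "twice_mean (twice_mean f) u = 4 / real deg ^ 2 * (m * (\<Sum>w\<in>V. if \<forall>i\<in>I. c w i = c u i then f w else 0))"
        unfolding twice_mean_iterated[OF u] sum_distrib_left by (intro sum.cong) auto
      then show ?thesis
        using m by (simp add: cls_if deg True power2_eq_square)
    qed
    then have "twice_mean (twice_mean (twice_mean f)) u = 4 * twice_mean f u" if "u \<in> V" for f u
      using that m by (simp add: cls_twice_mean)
    then show ?thesis
      using u by (simp add: eval_nat_numeral)
  next
    case False
    then have 3: "card (Q j) = 3" using q by simp
    let ?C = "cls (I - {j})"
    \<comment> \<open>With three elements in \<open>Q j\<close>, the factor at \<open>j\<close> is 2
      if the coordinates agree and 1 otherwise; this is the sum of the two indicators.\<close>
    have 1: "twice_mean (twice_mean f) u = (cls I f u + ?C f u) / m" if u: "u \<in> V" for f u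
    proof -
      have "m * (\<Prod>i\<in>I. real (card (Q i - {c u i, c w i}))) * f w
        = m * ((if \<forall>i\<in>I. c w i = c u i then f w else 0)
          + (if \<forall>i\<in>I - {j}. c w i = c u i then f w else 0))" if w: "w \<in> V" for w
        unfolding common[OF u w] all using coord[OF u j] coord[OF w j] finite_Q[OF j] 3
        by (auto simp: card2)
      then have "twice_mean (twice_mean f) u = 4 / real deg ^ 2 * (m * (cls I f u + ?C f u))"
        unfolding twice_mean_iterated[OF u] cls_if sum.distrib[symmetric] sum_distrib_left
        by (intro sum.cong) auto
      then show ?thesis
        using m by (simp add: deg 3 power2_eq_square)
    qed
    have 2: "twice_mean (twice_mean (twice_mean f)) u = twice_mean f u + ?C (twice_mean f) u / m" if "u \<in> V" for f u
      using that m by (simp add: 1 cls_twice_mean add_divide_distrib)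
    \<comment> \<open>Applying \<open>?C\<close> to identity \<open>2\<close> and using that
      \<open>?C\<close> squares to \<open>3 m\<close> times itself yields the factor
      \<open>1 + 3 = 4\<close>.\<close>
    have "?C (twice_mean (twice_mean (twice_mean f))) u = ?C (\<lambda>u. twice_mean f u + ?C (twice_mean f) u / m) u"
      by (intro cls_cong 2)
    also have "\<dots> = 4 * ?C (twice_mean f) u"
      using u j m by (simp add: cls_add cls_divide cls_cls 3)
    finally show ?thesis
      using u 2[OF u, of f] 2[OF u, of "twice_mean (twice_mean f)"] by (simp add: eval_nat_numeral)
  qed
qed

text \<open>Necessity uses \<open>2 \<mu>\<close> in lowest terms. For \<open>J = {i}\<close> it is
  \<open>-2 / (q - 1)\<close>: an even \<open>q\<close> must be 2, and an odd
  \<open>q = 2 w + 1\<close> gives \<open>-1 / w\<close>, hence 3. Two factors with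
  \<open>q = 3\<close> would give \<open>2 \<mu> = 1/2\<close>.\<close>

lemma periodic_iff:
  assumes "I \<noteq> {}"
  shows "(\<exists>\<tau>>0. \<forall>x. \<forall>a\<in>box_arcs. (step ^^ \<tau>) x a = x a) \<longleftrightarrow>
    (\<forall>i\<in>I. card (Q i) \<in> {2, 3}) \<and> (\<forall>i\<in>I. \<forall>j\<in>I. card (Q i) = 3 \<and> card (Q j) = 3 \<longrightarrow> i = j)"
proof (intro iffI conjI ballI impI)
  assume "\<exists>\<tau>>0. \<forall>x. \<forall>a\<in>box_arcs. (step ^^ \<tau>) x a = x a"
  then obtain \<tau> where \<tau>: "\<tau> > 0" "\<And>x a. a \<in> box_arcs \<Longrightarrow> (step ^^ \<tau>) x a = x a" by blast
  note unit = periodic_denominator[OF \<tau>(2) \<tau>(1)]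
  show "card (Q i) \<in> {2, 3}" if i: "i \<in> I" for i
  proof -
    have q: "card (Q i) \<ge> 2" using i by (rule card_Q)
    show ?thesis
    proof (cases "even (card (Q i))")
      case True
      have "real (card (Q i)) - 1 \<noteq> 0"
        using q by simp
      then have "is_unit (int (card (Q i)) - 1)"
        using i q True
        by (intro unit[of "{i}" "- 2"]) (auto simp: coprime_left_2_iff_odd divide_simps)
      then show ?thesis using q by auto
    next
      case False
      then obtain w where w: "card (Q i) = 2 * w + 1" by (elim oddE)
      have "is_unit (int w)"
        by (rule unit[of "{i}" "- 1"]) (use i q w in auto)
      then show ?thesis using w by auto
    qed
  qed
  show "i = j" if "i \<in> I" "j \<in> I" "card (Q i) = 3 \<and> card (Q j) = 3" for i j
  proof (rule ccontr)
    assume "i \<noteq> j"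
    then have "is_unit (2 :: int)"
      by (intro unit[of "{i, j}" 1]) (use that in auto)
    then show False by simp
  qed
next
  assume small: "(\<forall>i\<in>I. card (Q i) \<in> {2, 3}) \<and>
    (\<forall>i\<in>I. \<forall>j\<in>I. card (Q i) = 3 \<and> card (Q j) = 3 \<longrightarrow> i = j)"
  \<comment> \<open>The index with three residues if there is one, otherwise any index.\<close>
  obtain j where "j \<in> I" "\<And>i. i \<in> I - {j} \<Longrightarrow> card (Q i) = 2"
  proof (cases "\<exists>j\<in>I. card (Q j) = 3")
    case True
    then show ?thesis using small that by blast
  next
    case False
    then show ?thesis using small assms that by blast
  qed
  then have "(step ^^ 12) x a = x a" if "a \<in> box_arcs" for x a
    using small that by (intro periodic_if_small[of j]) auto
  then show "\<exists>\<tau>>0. \<forall>x. \<forall>a\<in>box_arcs. (step ^^ \<tau>) x a = x a"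
    by (intro exI[of _ 12]) auto
qed

end

section \<open>Products of local rings\<close>

text \<open>Finiteness provides a maximal element among the proper ideals containing
  \<open>x\<close>; the principal ideal of \<open>x\<close> is one of them.\<close>

lemma (in cring) nonunit_in_maximalideal:
  assumes fin: "finite (carrier R)" and x: "x \<in> carrier R" "x \<notin> Units R"
  obtains M where "maximalideal M R" "x \<in> M"
proof -
  define P where "P = {I. ideal I R \<and> x \<in> I \<and> \<one> \<notin> I}"
  have "P \<subseteq> Pow (carrier R)"
    by (auto simp: P_def dest: ideal.Icarr)
  then have "finite P"
    using fin finite_subset by blast
  moreover have "\<one> \<notin> PIdl x"
    using x unfolding cgenideal_def Units_def by (auto simp: m_comm)
  then have "PIdl x \<in> P"
    using cgenideal_ideal[OF x(1)] cgenideal_self[OF x(1)] by (simp add: P_def)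
  ultimately obtain M where M: "M \<in> P" "\<And>J. J \<in> P \<Longrightarrow> M \<subseteq> J \<Longrightarrow> J = M"
    using finite_has_maximal2[of P "PIdl x"] by metis
  have "maximalideal M R"
  proof (rule maximalidealI)
    show "ideal M R" "carrier R \<noteq> M"
      using M(1) by (auto simp: P_def)
    show "J = M \<or> J = carrier R" if J: "ideal J R" "M \<subseteq> J" for J
      using M J ideal.one_imp_carrier[OF J(1)] by (auto simp: P_def)
  qed
  then show ?thesis
    using that M(1) by (auto simp: P_def)
qed

text \<open>A nonunit lies in some maximal ideal, and \<open>M\<close> is the only one.\<close>

lemma local_ring_Units:
  fixes R (structure)
  assumes "local_ring_with R M" "finite (carrier R)"
  shows "Units R = carrier R - M"
proof -
  interpret cring R using assms(1) by (simp add: local_ring_with_def)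
  have eq: "{I. maximalideal I R} = {M}"
    using assms(1) by (simp add: local_ring_with_def)
  then interpret maximalideal M R by auto
  have "x \<in> Units R \<longleftrightarrow> x \<notin> M" if x: "x \<in> carrier R" for x
  proof
    assume u: "x \<in> Units R"
    show "x \<notin> M"
    proof
      assume "x \<in> M"
      then have "inv x \<otimes> x \<in> M"
        using u by (intro I_l_closed) auto
      then show False
        using u one_imp_carrier I_notcarr by simp
    qed
  next
    assume "x \<notin> M"
    then show "x \<in> Units R"
      using nonunit_in_maximalideal[OF assms(2) x] eq by blast
  qed
  then show ?thesis by auto
qed

section \<open>Products of rings through their projections\<close>

lemma RDirProd_list_nth_hom:
  assumes "i < length Rs"
  shows "(\<lambda>xs. xs ! i) \<in> ring_hom (RDirProd_list Rs) (Rs ! i)"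
  using assms
proof (induction Rs arbitrary: i)
  case (Cons R Rs)
  let ?c = "\<lambda>(a, as). a # as"
  note hom = ring_hom_memE[OF RDirProd_list_hom1[of R Rs]]
  have carr: "carrier (RDirProd_list (R # Rs)) = ?c ` carrier (RDirProd R (RDirProd_list Rs))"
    by (simp add: RDirProd_list_carrier RDirProd_carrier)
  have mult: "(a # as) \<otimes>\<^bsub>RDirProd_list (R # Rs)\<^esub> (b # bs)
      = (a \<otimes>\<^bsub>R\<^esub> b) # (as \<otimes>\<^bsub>RDirProd_list Rs\<^esub> bs)"
    and add: "(a # as) \<oplus>\<^bsub>RDirProd_list (R # Rs)\<^esub> (b # bs)
      = (a \<oplus>\<^bsub>R\<^esub> b) # (as \<oplus>\<^bsub>RDirProd_list Rs\<^esub> bs)"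
    if "a \<in> carrier R" "as \<in> carrier (RDirProd_list Rs)"
      "b \<in> carrier R" "bs \<in> carrier (RDirProd_list Rs)" for a as b bs
    using that hom(2)[of "(a, as)" "(b, bs)"] hom(3)[of "(a, as)" "(b, bs)"]
    by (simp_all add: RDirProd_carrier) (simp_all add: RDirProd_def DirProd_def monoid.defs)
  have one: "\<one>\<^bsub>RDirProd_list (R # Rs)\<^esub> = \<one>\<^bsub>R\<^esub> # \<one>\<^bsub>RDirProd_list Rs\<^esub>"
    by (simp add: RDirProd_list_one)
  show ?case
  proof (cases i)
    case 0
    then show ?thesis
      by (intro ring_hom_memI) (auto simp: carr RDirProd_carrier mult add one)
  next
    case (Suc j)
    then have "(\<lambda>xs. xs ! j) \<in> ring_hom (RDirProd_list Rs) (Rs ! j)"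
      using Cons by simp
    from ring_hom_memE[OF this] show ?thesis
      unfolding Suc by (intro ring_hom_memI) (auto simp: carr RDirProd_carrier mult add one)
  qed
qed simp

lemma RDirProd_list_nth_bij:
  "bij_betw (\<lambda>xs. \<lambda>i\<in>{..<length Rs}. xs ! i) (carrier (RDirProd_list Rs))
     (\<Pi>\<^sub>E i\<in>{..<length Rs}. carrier (Rs ! i))"
proof (rule bij_betwI[where g = "\<lambda>g. map g [0..<length Rs]"])
  show "(\<lambda>xs. \<lambda>i\<in>{..<length Rs}. xs ! i) \<in> carrier (RDirProd_list Rs) \<rightarrow> (\<Pi>\<^sub>E i\<in>{..<length Rs}. carrier (Rs ! i))"
    by (auto simp: RDirProd_list_carrier_mem)
  show "(\<lambda>g. map g [0..<length Rs]) \<in> (\<Pi>\<^sub>E i\<in>{..<length Rs}. carrier (Rs ! i)) \<rightarrow> carrier (RDirProd_list Rs)"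
  proof
    fix g assume g: "g \<in> (\<Pi>\<^sub>E i\<in>{..<length Rs}. carrier (Rs ! i))"
    show "map g [0..<length Rs] \<in> carrier (RDirProd_list Rs)"
      by (rule RDirProd_list_carrier_memI) (use g in \<open>auto simp: PiE_iff\<close>)
  qed
  show "map (\<lambda>i\<in>{..<length Rs}. xs ! i) [0..<length Rs] = xs" if "xs \<in> carrier (RDirProd_list Rs)" for xs
    using RDirProd_list_carrier_mem(1)[OF that] by (auto intro: nth_equalityI)
  show "(\<lambda>i\<in>{..<length Rs}. map g [0..<length Rs] ! i) = g"
    if "g \<in> (\<Pi>\<^sub>E i\<in>{..<length Rs}. carrier (Rs ! i))" for g
    using that by (auto simp: PiE_iff extensional_def)
qed

text \<open>A product decomposition is given by jointly bijective projections, which keeps the list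
  encoding out of the later arguments.\<close>

locale ring_product =
  fixes R :: "'a ring" (structure) and I :: "'i set" and S :: "'i \<Rightarrow> 'b ring" and p :: "'i \<Rightarrow> 'a \<Rightarrow> 'b"
  assumes cring: "cring R"
    and factor_cring: "i \<in> I \<Longrightarrow> cring (S i)"
    and hom: "i \<in> I \<Longrightarrow> p i \<in> ring_hom R (S i)"
    and bij: "bij_betw (\<lambda>x. \<lambda>i\<in>I. p i x) (carrier R) (\<Pi>\<^sub>E i\<in>I. carrier (S i))"
begin

sublocale R: cring R by (rule cring)

lemma hom_cring: "i \<in> I \<Longrightarrow> ring_hom_cring R (S i) (p i)"
  by (intro ring_hom_cringI cring factor_cring hom)

lemma eqI:
  assumes "x \<in> carrier R" "y \<in> carrier R" "\<And>i. i \<in> I \<Longrightarrow> p i x = p i y"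
  shows "x = y"
  using assms bij_betw_imp_inj_on[OF bij] by (auto simp: inj_on_def restrict_def fun_eq_iff)

lemma ex_element:
  assumes "\<And>i. i \<in> I \<Longrightarrow> g i \<in> carrier (S i)"
  obtains x where "x \<in> carrier R" "\<And>i. i \<in> I \<Longrightarrow> p i x = g i"
proof -
  have "restrict g I \<in> (\<lambda>x. \<lambda>i\<in>I. p i x) ` carrier R"
    using assms bij by (auto simp: bij_betw_def)
  then obtain x where "x \<in> carrier R" "restrict g I = (\<lambda>i\<in>I. p i x)" by blast
  then show ?thesis
    by (intro that[of x]) (metis restrict_apply')+
qed

lemma Units_iff:
  assumes x: "x \<in> carrier R"
  shows "x \<in> Units R \<longleftrightarrow> (\<forall>i\<in>I. p i x \<in> Units (S i))"
proof
  assume u: "x \<in> Units R"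
  show "\<forall>i\<in>I. p i x \<in> Units (S i)"
  proof
    fix i assume i: "i \<in> I"
    interpret ring_hom_cring R "S i" "p i" by (rule hom_cring[OF i])
    have "p i (inv x) \<otimes>\<^bsub>S i\<^esub> p i x = \<one>\<^bsub>S i\<^esub>" "p i x \<otimes>\<^bsub>S i\<^esub> p i (inv x) = \<one>\<^bsub>S i\<^esub>"
      using u x by (simp_all flip: hom_mult)
    then show "p i x \<in> Units (S i)"
      using u x unfolding Units_def[of "S i"] by (auto intro!: bexI[of _ "p i (inv x)"])
  qed
next
  assume u: "\<forall>i\<in>I. p i x \<in> Units (S i)"
  have "inv\<^bsub>S i\<^esub> p i x \<in> carrier (S i)" "p i x \<otimes>\<^bsub>S i\<^esub> inv\<^bsub>S i\<^esub> p i x = \<one>\<^bsub>S i\<^esub>" if "i \<in> I" for i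
  proof -
    interpret ring_hom_cring R "S i" "p i" by (rule hom_cring[OF that])
    show "inv\<^bsub>S i\<^esub> p i x \<in> carrier (S i)" "p i x \<otimes>\<^bsub>S i\<^esub> inv\<^bsub>S i\<^esub> p i x = \<one>\<^bsub>S i\<^esub>"
      using u that by auto
  qed
  note inv = this
  \<comment> \<open>The inverse of \<open>x\<close> is assembled from the inverses of its
    components.\<close>
  obtain y where y: "y \<in> carrier R" "\<And>i. i \<in> I \<Longrightarrow> p i y = inv\<^bsub>S i\<^esub> p i x"
    using ex_element[of "\<lambda>i. inv\<^bsub>S i\<^esub> p i x"] inv(1) by metis
  have "x \<otimes> y = \<one>"
  proof (rule eqI)
    show "p i (x \<otimes> y) = p i \<one>" if "i \<in> I" for i
      using ring_hom_mult[OF hom[OF that] x y(1)] ring_hom_one[OF hom[OF that]]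
        inv(2)[OF that] y(2)[OF that] by simp
  qed (use x y in auto)
  then show "x \<in> Units R"
    using x y(1) R.m_comm[of y x] unfolding Units_def by auto
qed

end

text \<open>Factors are numbered from 1 and list positions from 0, whence the index
  \<open>i - 1\<close> and the reindexing bijection.\<close>

lemma ring_product_RDirProd_list:
  fixes Rs :: "nat \<Rightarrow> 'b ring"
  assumes "cring R" "\<And>i. i \<in> {1..s} \<Longrightarrow> cring (Rs i)"
    and "h \<in> ring_iso R (RDirProd_list (map Rs [1..<Suc s]))"
  shows "ring_product R {1..s} Rs (\<lambda>i x. h x ! (i - 1))"
proof (rule ring_product.intro)
  let ?L = "map Rs [1..<Suc s]"
  have nth: "?L ! (i - 1) = Rs i" "i - 1 < length ?L" if "i \<in> {1..s}" for i
    using that by (auto simp del: upt_Suc)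
  show "(\<lambda>x. h x ! (i - 1)) \<in> ring_hom R (Rs i)" if i: "i \<in> {1..s}" for i
  proof -
    have "h \<in> ring_hom R (RDirProd_list ?L)"
      using assms(3) by (simp add: ring_iso_def)
    then show ?thesis
      using ring_hom_trans[OF _ RDirProd_list_nth_hom[OF nth(2)[OF i]]] unfolding nth(1)[OF i]
      by (simp add: comp_def)
  qed
  have "bij_betw (\<lambda>g. \<lambda>i\<in>{1..s}. g (i - 1)) (\<Pi>\<^sub>E i\<in>{..<length ?L}. carrier (?L ! i))
      (\<Pi>\<^sub>E i\<in>{1..s}. carrier (Rs i))"
  proof (rule bij_betwI[where g = "\<lambda>g. \<lambda>i\<in>{..<s}. g (Suc i)"])
    show "(\<lambda>g. \<lambda>i\<in>{1..s}. g (i - 1)) \<in> (\<Pi>\<^sub>E i\<in>{..<length ?L}. carrier (?L ! i))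
      \<rightarrow> (\<Pi>\<^sub>E i\<in>{1..s}. carrier (Rs i))"
    proof
      fix g assume g: "g \<in> (\<Pi>\<^sub>E i\<in>{..<length ?L}. carrier (?L ! i))"
      have "g (i - 1) \<in> carrier (Rs i)" if "i \<in> {1..s}" for i
        using PiE_mem[OF g, of "i - 1"] nth[OF that] by simp
      then show "(\<lambda>i\<in>{1..s}. g (i - 1)) \<in> (\<Pi>\<^sub>E i\<in>{1..s}. carrier (Rs i))" by auto
    qed
    show "(\<lambda>g. \<lambda>i\<in>{..<s}. g (Suc i)) \<in> (\<Pi>\<^sub>E i\<in>{1..s}. carrier (Rs i))
      \<rightarrow> (\<Pi>\<^sub>E i\<in>{..<length ?L}. carrier (?L ! i))"
      by (auto simp del: upt_Suc split: if_splits)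
  qed (auto simp: PiE_iff extensional_def fun_eq_iff simp del: upt_Suc)
  from bij_betw_trans[OF bij_betw_trans[OF ring_iso_memE(5)[OF assms(3)] RDirProd_list_nth_bij] this]
  have b: "bij_betw ((\<lambda>g. \<lambda>i\<in>{1..s}. g (i - 1)) \<circ> ((\<lambda>xs. \<lambda>i\<in>{..<length ?L}. xs ! i) \<circ> h))
     (carrier R) (\<Pi>\<^sub>E i\<in>{1..s}. carrier (Rs i))" .
  have "(\<lambda>g. \<lambda>i\<in>{1..s}. g (i - 1)) \<circ> ((\<lambda>xs. \<lambda>i\<in>{..<length ?L}. xs ! i) \<circ> h)
    = (\<lambda>x. \<lambda>i\<in>{1..s}. h x ! (i - 1))"
    using nth(2) by (auto simp: fun_eq_iff simp del: upt_Suc)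
  with b show "bij_betw (\<lambda>x. \<lambda>i\<in>{1..s}. h x ! (i - 1)) (carrier R) (\<Pi>\<^sub>E i\<in>{1..s}. carrier (Rs i))"
    by simp
qed (fact assms(1), fact assms(2))

text \<open>The additive order of \<open>\<one>\<close> divides the prime \<open>p\<close> and is
  not 1, so it is \<open>p\<close>. The multiples of \<open>\<one>\<close> therefore exhaust the
  ring.\<close>

lemma residue_ring_iso:
  fixes F :: "'c ring" (structure)
  assumes "cring F" and p: "prime p" and card: "card (carrier F) = p"
  shows "F \<simeq> residue_ring (int p)"
proof -
  interpret cring F by fact
  have p1: "p > 1"
    using p by (rule prime_gt_1_nat)
  then have fin: "finite (carrier F)"
    using card by (metis card.infinite not_less_zero)
  have "\<one> \<noteq> \<zero>"
    using card p1 one_zeroD by auto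
  have dvd_p: "add.ord \<one> dvd p"
    using add.ord_dvd_group_order[of \<one>] card by (simp add: order_def)
  have "add.ord \<one> \<noteq> 1"
    using add.ord_eq_1[of \<one>] \<open>\<one> \<noteq> \<zero>\<close> by simp
  then have ord: "add.ord \<one> = p"
    using dvd_p p by (auto simp: prime_nat_iff)
  define e :: "nat \<Rightarrow> 'c" where "e n = add_pow F n \<one>" for n
  have zero_iff: "e n = \<zero> \<longleftrightarrow> p dvd n" for n :: nat
    unfolding e_def by (rule add.pow_eq_id[OF one_closed, unfolded ord])
  have e_closed: "e n \<in> carrier F" for n
    by (simp add: e_def)
  have e_add: "e m \<oplus> e n = e (m + n)" for m n
    unfolding e_def by (rule add.nat_pow_mult[OF one_closed])
  have e_mult: "e m \<otimes> e n = e (m * n)" for m n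
    unfolding e_def by (simp add: add_pow_ldistr add_pow_rdistr add.nat_pow_pow mult.commute)
  \<comment> \<open>This makes \<open>e\<close> compatible with the reductions modulo
    \<open>p\<close> in the operations of \<open>residue_ring\<close>.\<close>
  have mod: "e (n mod p) = e n" for n :: nat
  proof -
    have "e n = e (p * (n div p)) \<oplus> e (n mod p)"
      unfolding e_add by (simp only: mult_div_mod_eq)
    also have "e (p * (n div p)) = \<zero>"
      by (simp add: zero_iff)
    finally show ?thesis by (simp add: e_closed)
  qed
  define f where "f x = e (nat x)" for x :: int
  let ?Z = "residue_ring (int p)"
  have Z: "carrier ?Z = {0..int p - 1}" "x \<otimes>\<^bsub>?Z\<^esub> y = (x * y) mod int p" "x \<oplus>\<^bsub>?Z\<^esub> y = (x + y) mod int p"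
      "\<one>\<^bsub>?Z\<^esub> = 1" for x y
    by (simp_all add: residue_ring_def)
  have nat_eq: "m = n" if "e m = e n" "m \<le> n" "n < p" for m n :: nat
  proof -
    have "e n = e m \<oplus> e (n - m)"
      unfolding e_add using that(2) by simp
    then have "e (n - m) = \<zero>"
      using that(1) add.r_cancel_one'[OF e_closed e_closed, of m "n - m"] add.m_comm[OF e_closed e_closed, of m "n - m"] by simp
    then show ?thesis
      using that zero_iff[of "n - m"] by (auto dest: dvd_imp_le)
  qed
  have inj: "inj_on f (carrier ?Z)"
  proof (rule inj_onI)
    fix x y assume "x \<in> carrier ?Z" "y \<in> carrier ?Z" "f x = f y"
    moreover from this have "nat x < p" "nat y < p"
      by (auto simp: Z)
    ultimately have "nat x = nat y"
      using nat_eq[of "nat x" "nat y"] nat_eq[of "nat y" "nat x"]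
      unfolding f_def by (metis nat_le_linear)
    then show "x = y"
      using \<open>x \<in> carrier ?Z\<close> \<open>y \<in> carrier ?Z\<close> by (auto simp: Z)
  qed
  have "f ` carrier ?Z \<subseteq> carrier F"
    by (auto simp: f_def e_closed)
  moreover have "card (f ` carrier ?Z) = card (carrier F)"
    using card by (simp add: card_image[OF inj]) (simp add: Z)
  ultimately have bij: "bij_betw f (carrier ?Z) (carrier F)"
    using inj card_subset_eq[OF fin] by (simp add: bij_betw_def)
  have "f \<in> ring_iso ?Z F"
  proof (rule ring_iso_memI)
    fix x y assume xy: "x \<in> carrier ?Z" "y \<in> carrier ?Z"
    show "f x \<in> carrier F" by (simp add: f_def e_closed)
    have "f (x \<otimes>\<^bsub>?Z\<^esub> y) = e (nat x * nat y)"
      using xy by (simp add: f_def Z nat_mod_distrib nat_mult_distrib mod)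
    also have "\<dots> = f x \<otimes> f y"
      by (simp add: f_def e_mult)
    finally show "f (x \<otimes>\<^bsub>?Z\<^esub> y) = f x \<otimes> f y" .
    show "f (x \<oplus>\<^bsub>?Z\<^esub> y) = f x \<oplus> f y"
      using xy by (simp add: f_def Z nat_mod_distrib nat_add_distrib mod e_add)
  qed (use bij in \<open>simp_all add: f_def Z e_def\<close>)
  moreover have "ring ?Z"
    using residues.cring[of "int p"] p1 by (simp add: residues_def cring.axioms(1))
  ultimately show ?thesis
    using ring_iso_sym is_ring_iso_def by blast
qed

text \<open>The cosets of \<open>M\<close> partition \<open>S\<close> into classes of size
  \<open>card M\<close>, and there are at least two as \<open>M\<close> is proper. Units are the
  complement of \<open>M\<close>, so a difference is a unit exactly when the cosets differ.\<close>

lemma local_ring_quotient: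
  fixes S (structure)
  assumes local: "local_ring_with S M" and fin: "finite (carrier S)"
  shows "cring (S Quot M)"
    and "finite (carrier (S Quot M))"
    and "card (carrier (S Quot M)) * card M = card (carrier S)"
    and "card M > 0"
    and "card (carrier (S Quot M)) \<ge> 2"
    and "\<And>x. x \<in> carrier S \<Longrightarrow> M +> x \<in> carrier (S Quot M)"
    and "\<And>g. g \<in> carrier (S Quot M) \<Longrightarrow> {x \<in> carrier S. M +> x = g} = g"
    and "\<And>g. g \<in> carrier (S Quot M) \<Longrightarrow> card g = card M"
    and "\<And>x y. x \<in> carrier S \<Longrightarrow> y \<in> carrier S \<Longrightarrow> x \<ominus> y \<in> Units S \<longleftrightarrow> M +> x \<noteq> M +> y"
proof -
  interpret cring S using local by (simp add: local_ring_with_def)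
  interpret maximalideal M S using local by (auto simp: local_ring_with_def)
  have Q: "carrier (S Quot M) = a_rcosets M"
    by (simp add: FactRing_def)
  show "cring (S Quot M)"
    by (rule quotient_is_cring[OF cring_axioms])
  have M: "M \<subseteq> carrier S"
    using Icarr by blast
  show finQ: "finite (carrier (S Quot M))"
    using fin rcosets_subset_PowG[OF additive_subgroup_axioms] unfolding Q
    by (meson finite_Pow_iff finite_subset)
  show lag: "card (carrier (S Quot M)) * card M = card (carrier S)"
    using a_lagrange[OF fin additive_subgroup_axioms] by (simp add: Q order_def)
  show coset: "M +> x \<in> carrier (S Quot M)" if "x \<in> carrier S" for x
    using a_rcosetsI[OF M that] by (simp add: Q)
  show cardM: "card M > 0"
    using finite_subset[OF M fin] zero_closed
    by (metis card_gt_0_iff empty_iff)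
  show "card g = card M" if "g \<in> carrier (S Quot M)" for g
    using a_card_cosets_equal[OF _ M fin] that by (simp add: Q)
  have diff: "x \<ominus> y \<in> M \<longleftrightarrow> M +> x = M +> y" if "x \<in> carrier S" "y \<in> carrier S" for x y
    using a_rcos_module_minus[OF ring_axioms that(2) that(1)] a_repr_independence'[of x y]
      a_rcos_self[OF that(1)] that by metis
  show "x \<ominus> y \<in> Units S \<longleftrightarrow> M +> x \<noteq> M +> y" if "x \<in> carrier S" "y \<in> carrier S" for x y
    using diff[OF that] that by (simp add: local_ring_Units[OF local fin])
  show "{x \<in> carrier S. M +> x = g} = g" if g: "g \<in> carrier (S Quot M)" for g
  proof -
    obtain y where y: "y \<in> carrier S" "g = M +> y"
      using g by (auto simp: Q A_RCOSETS_def')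
    have "g \<subseteq> carrier S"
      using g a_rcosets_carrier by (simp add: Q)
    then show ?thesis
      using a_repr_independence'[OF _ y(1)] a_rcos_self y(2) by fastforce
  qed
  have "card (carrier (S Quot M)) \<noteq> 0"
    using finQ coset[OF one_closed] by auto
  moreover have "card (carrier (S Quot M)) \<noteq> 1"
    using lag I_notcarr card_subset_eq[OF fin M] by auto
  ultimately show "card (carrier (S Quot M)) \<ge> 2"
    by linarith
qed

text \<open>This turns the isomorphism conditions into conditions on orders, which are what the
  graph determines.\<close>

lemma quotient_iso_residue_ring_iff:
  assumes "local_ring_with S M" "finite (carrier S)" "prime p"
  shows "S Quot M \<simeq> residue_ring (int p) \<longleftrightarrow> card (carrier (S Quot M)) = p"
proof
  assume "S Quot M \<simeq> residue_ring (int p)"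
  from ring_iso_same_card[OF this] show "card (carrier (S Quot M)) = p"
    by (simp add: residue_ring_def)
qed (use residue_ring_iso local_ring_quotient(1) assms in blast)

section \<open>The unitary Cayley graph in residue coordinates\<close>

context ring_product begin

text \<open>A tuple \<open>g\<close> of cosets has as its fibre the preimage of the product of these
  cosets, hence \<open>\<Prod>i\<in>I. card (M i)\<close> elements. Adjacency is tested
  componentwise because units are.\<close>

lemma coordinates_local:
  assumes I: "finite I" "I \<noteq> {}" and fin: "finite (carrier R)"
    and local: "\<And>i. i \<in> I \<Longrightarrow> local_ring_with (S i) (M i)"
    and fin_S: "\<And>i. i \<in> I \<Longrightarrow> finite (carrier (S i))"
  defines "c \<equiv> \<lambda>x i. M i +>\<^bsub>S i\<^esub> p i x"
  shows "coordinates (carrier R) I (\<lambda>i. carrier (S i Quot M i)) c (\<Prod>i\<in>I. card (M i))"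
    and "parcs (unitary_cayley_graph R) = coordinates.box_arcs (carrier R) I c"
proof -
  note quot = local_ring_quotient[OF local fin_S]
  have p_closed: "p i x \<in> carrier (S i)" if "i \<in> I" "x \<in> carrier R" for i x
    using ring_hom_closed[OF hom] that by blast
  show coords: "coordinates (carrier R) I (\<lambda>i. carrier (S i Quot M i)) c (\<Prod>i\<in>I. card (M i))"
  proof
    show "(\<Prod>i\<in>I. card (M i)) > 0"
      using quot(4) by (intro prod_pos) auto
    fix g assume g: "g \<in> (\<Pi>\<^sub>E i\<in>I. carrier (S i Quot M i))"
    have g_sub: "g i \<subseteq> carrier (S i)" if "i \<in> I" for i
      using quot(7)[OF that that] g that by blast
    have *: "y \<in> g i \<longleftrightarrow> M i +>\<^bsub>S i\<^esub> y = g i" if "i \<in> I" "y \<in> carrier (S i)" for i y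
      using quot(7)[OF that(1) that(1), of "g i"] g that by blast
    have iff: "restrict (c v) I = g \<longleftrightarrow> (\<forall>i\<in>I. p i v \<in> g i)" if "v \<in> carrier R" for v
    proof -
      have "restrict (c v) I = g \<longleftrightarrow> (\<forall>i\<in>I. c v i = g i)"
        using g by (auto simp: PiE_iff extensional_def fun_eq_iff)
      then show ?thesis
        using *[OF _ p_closed] that by (simp add: c_def)
    qed
    have "bij_betw (\<lambda>x. \<lambda>i\<in>I. p i x) {v \<in> carrier R. restrict (c v) I = g} (Pi\<^sub>E I g)"
    proof (rule bij_betw_subset[OF bij])
      show "(\<lambda>x. \<lambda>i\<in>I. p i x) ` {v \<in> carrier R. restrict (c v) I = g} = Pi\<^sub>E I g"
      proof (intro equalityI subsetI)
        fix h assume h: "h \<in> Pi\<^sub>E I g"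
        then obtain x where x: "x \<in> carrier R" "\<And>i. i \<in> I \<Longrightarrow> p i x = h i"
          using ex_element[of h] g_sub by (metis PiE_mem subsetD)
        then have "restrict (c x) I = g"
          using h by (auto simp: iff PiE_iff)
        moreover have "h = (\<lambda>i\<in>I. p i x)"
          using h x(2) by (auto simp: PiE_iff extensional_def fun_eq_iff)
        ultimately show "h \<in> (\<lambda>x. \<lambda>i\<in>I. p i x) ` {v \<in> carrier R. restrict (c v) I = g}"
          using x(1) by blast
      next
        fix h assume "h \<in> (\<lambda>x. \<lambda>i\<in>I. p i x) ` {v \<in> carrier R. restrict (c v) I = g}"
        then obtain x where x: "x \<in> carrier R" "restrict (c x) I = g" and h: "h = (\<lambda>i\<in>I. p i x)"
          by blast
        show "h \<in> Pi\<^sub>E I g"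
          unfolding h using iffD1[OF iff[OF x(1)] x(2)] by (simp add: restrict_PiE_iff)
      qed
    qed auto
    then have "card {v \<in> carrier R. restrict (c v) I = g} = card (Pi\<^sub>E I g)"
      by (rule bij_betw_same_card)
    also have "\<dots> = (\<Prod>i\<in>I. card (M i))"
      using quot(8) g I(1) by (auto simp: card_PiE intro!: prod.cong)
    finally show "card {v \<in> carrier R. restrict (c v) I = g} = (\<Prod>i\<in>I. card (M i))" .
  qed (use fin I quot(2,5,6) p_closed in \<open>auto simp: c_def\<close>)
  have adj: "u \<noteq> v \<and> u \<ominus> v \<in> Units R \<longleftrightarrow> (\<forall>i\<in>I. c u i \<noteq> c v i)"
    if uv: "u \<in> carrier R" "v \<in> carrier R" for u v
  proof -
    have diff: "p i (u \<ominus> v) = p i u \<ominus>\<^bsub>S i\<^esub> p i v" if "i \<in> I" for i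
    proof -
      interpret ring_hom_cring R "S i" "p i" by (rule hom_cring[OF that])
      show ?thesis using uv by (simp add: a_minus_def)
    qed
    have "u \<ominus> v \<in> Units R \<longleftrightarrow> (\<forall>i\<in>I. c u i \<noteq> c v i)"
      using quot(9) uv p_closed by (simp add: Units_iff diff c_def)
    \<comment> \<open>As \<open>I\<close> is nonempty, vertices whose residues all differ are
      distinct.\<close>
    then show ?thesis
      using I(2) by auto
  qed
  show "parcs (unitary_cayley_graph R) = coordinates.box_arcs (carrier R) I c"
    unfolding coordinates.box_arcs_def[OF coords] unitary_cayley_graph_def using adj by auto
qed

end

theorem theorem4p3:
  fixes R :: "'a ring" and s :: nat and Rs :: "nat \<Rightarrow> 'b ring" and M :: "nat \<Rightarrow> 'b set"
  assumes "cring R" and "finite (carrier R)" and "\<one>\<^bsub>R\<^esub> \<noteq> \<zero>\<^bsub>R\<^esub>"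
    and "s \<ge> 1"
    and "\<And>i. i \<in> {1..s} \<Longrightarrow> local_ring_with (Rs i) (M i)"
    and "\<And>i. i \<in> {1..s} \<Longrightarrow> finite (carrier (Rs i))"
    and "R \<simeq> RDirProd_list (map Rs [1..<Suc s])"
    and "\<And>i j. 1 \<le> i \<Longrightarrow> i \<le> j \<Longrightarrow> j \<le> s \<Longrightarrow>
           real (card (carrier (Rs i))) / real (card (M i))
             \<ge> real (card (carrier (Rs j))) / real (card (M j))"
  shows "grover_periodic (unitary_cayley_graph R) \<longleftrightarrow>
           (Rs 1 Quot M 1 \<simeq> residue_ring 2 \<or> Rs 1 Quot M 1 \<simeq> residue_ring 3) \<and>
           (\<forall>i\<in>{2..s}. Rs i Quot M i \<simeq> residue_ring 2)"
proof -
  obtain h where "h \<in> ring_iso R (RDirProd_list (map Rs [1..<Suc s]))"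
    using assms(7) by (auto simp: is_ring_iso_def)
  with assms(1,5) interpret ring_product R "{1..s}" Rs "\<lambda>i x. h x ! (i - 1)"
    by (intro ring_product_RDirProd_list) (auto simp: local_ring_with_def)
  let ?q = "\<lambda>i. card (carrier (Rs i Quot M i))"
  let ?c = "\<lambda>x i. M i +>\<^bsub>Rs i\<^esub> h x ! (i - 1)"
  have ne: "{1..s} \<noteq> {}" using assms(4) by simp
  note coords = coordinates_local[OF finite_atLeastAtMost ne assms(2,5,6)]
  interpret coordinates "carrier R" "{1..s}" "\<lambda>i. carrier (Rs i Quot M i)" ?c "\<Prod>i\<in>{1..s}. card (M i)"
    by (rule coords(1))
  have "pverts (unitary_cayley_graph R) = carrier R"
    by (simp add: unitary_cayley_graph_def)
  then have periodic: "grover_periodic (unitary_cayley_graph R) \<longleftrightarrow>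
      (\<forall>i\<in>{1..s}. ?q i \<in> {2, 3}) \<and> (\<forall>i\<in>{1..s}. \<forall>j\<in>{1..s}. ?q i = 3 \<and> ?q j = 3 \<longrightarrow> i = j)"
    using grover_periodic_iff[OF _ coords(2)] periodic_iff[OF ne] by simp
  \<comment> \<open>By Lagrange the ratio that orders the factors is the order of the residue
    field.\<close>
  have q: "real (card (carrier (Rs i))) / real (card (M i)) = ?q i" if "i \<in> {1..s}" for i
    using local_ring_quotient(3,4)[OF assms(5,6)[OF that]]
    by (simp add: field_simps flip: of_nat_mult)
  have antimono: "?q j \<le> ?q 1" if "j \<in> {1..s}" for j
    using assms(8)[of 1 j] q[of 1] q[OF that] that assms(4) by simp
  have iso: "Rs i Quot M i \<simeq> residue_ring 2 \<longleftrightarrow> ?q i = 2"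
    "Rs i Quot M i \<simeq> residue_ring 3 \<longleftrightarrow> ?q i = 3" if "i \<in> {1..s}" for i
    using quotient_iso_residue_ring_iff[OF assms(5,6)[OF that], of 2]
      quotient_iso_residue_ring_iff[OF assms(5,6)[OF that], of 3] by simp_all
  have "(\<forall>i\<in>{1..s}. ?q i \<in> {2, 3}) \<and> (\<forall>i\<in>{1..s}. \<forall>j\<in>{1..s}. ?q i = 3 \<and> ?q j = 3 \<longrightarrow> i = j) \<longleftrightarrow>
    (?q 1 = 2 \<or> ?q 1 = 3) \<and> (\<forall>i\<in>{2..s}. ?q i = 2)" (is "?l \<longleftrightarrow> ?r")
  proof
    assume l: ?l
    have "?q i = 2" if i: "i \<in> {2..s}" for i
    proof (rule ccontr)
      assume "?q i \<noteq> 2"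
      have mem: "1 \<in> {1..s}" "i \<in> {1..s}"
        using i assms(4) by auto
      have "?q 1 \<in> {2, 3}" "?q i \<in> {2, 3}"
        by (rule bspec[OF conjunct1[OF l]], rule mem)+
      \<comment> \<open>The ordering forces \<open>?q 1\<close> to be 3 along with
        \<open>?q i\<close>, against the uniqueness of the factor with three residues.\<close>
      then have "?q i = 3" "?q 1 = 3"
        using \<open>?q i \<noteq> 2\<close> antimono[OF mem(2)] by auto
      then have "i = 1"
        using conjunct2[OF l] mem by blast
      then show False using i by simp
    qed
    moreover have "?q 1 \<in> {2, 3}"
      by (rule bspec[OF conjunct1[OF l]]) (use assms(4) in simp)
    ultimately show ?r by simp
  next
    assume r: ?r
    have "?q i \<in> {2, 3}" "?q i = 3 \<Longrightarrow> i = 1" if "i \<in> {1..s}" for i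
      using r that by (cases "i = 1"; simp)+
    then show ?l by blast
  qed
  moreover have "(\<forall>i\<in>{2..s}. Rs i Quot M i \<simeq> residue_ring 2) \<longleftrightarrow> (\<forall>i\<in>{2..s}. ?q i = 2)"
    by (intro ball_cong iso refl) simp
  ultimately show ?thesis
    unfolding periodic using iso[of 1] assms(4) by simp
qed

end
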